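(* Set $w:=W(2n/\pi)$. For each integer $K\ge1$, as $n\to\infty$, $$b_{2n}=4\pi^2\frac{e^{7w/4-w^2/16}}{(2n)!}\sqrt{\frac{2w}{w+1}}\left(\frac{w}{4e^{1/w}}\right)^{2n}\left(1+\sum_{k=1}^{K-1}\frac{\tau_k(w)}{n^k}+O\!\left(\frac{\log^{3K}(n)}{n^K}\right)\right),$$ with an implied constant depending only on $K$. Each $\tau_k(w)$ is a rational function of $w$ (defined below) of size $O(\log^{3k}(n))$.
   Context: $\Xi(z):=\xi(1/2+iz)$ with $\xi$ the Riemann xi function. The numbers $b_{2n}$ are Turán's coefficients in the expansion $\Xi(z)=\sum_{n\ge0}(-1)^nb_{2n}H_{2n}(z)$ ($H_m$ Hermite polynomials with generating function $e^{2Xt-t^2}$); explicitly $b_{2n}=\frac{1}{2^{2n-1}(2n)!}\int_0^\infty x^{2n}e^{-x^2/4}\Phi(x)\,dx$, where $\theta(t)=\sum_{k\in\mathbb Z}e^{-\pi k^2t}$, $\omega(t)=\tfrac12(3t\theta'(t)+2t^2\theta''(t))$, $\Phi(x)=2e^{x/2}\omega(e^{2x})$. $W$ is the Lambert function. Bell polynomials: $(p_1x+p_2x^2+\cdots)^j=\sum_{i\ge j}\hat B_{i,j}(p_1,p_2,\dots)x^i$. Let $\ell_i(u):=\sum_{j=1}^i\hat B_{i,j}(1,-\tfrac12,\tfrac13,\dots)\frac{(-1)^{j+1}}{j u^j}$, $p_i(v):=\sum_{j=0}^i\frac1{j!}(-\tfrac v8)^j\hat B_{i,j}(1,-\tfrac12,\tfrac13,\dots)$,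 $q_i:=\sum_{j=0}^{\lfloor i/2\rfloor}\frac1{j!}(-\tfrac1{16})^j\hat B_{i,2j}(1,-\tfrac12,\tfrac13,\dots)$. For real $\beta$ let $f^{(\beta)}_m(v):=\sum_{j_1+j_2+j_3=m}\binom{\beta}{j_1}p_{j_2}(v)q_{j_3}$ and $$A^{(\beta)}_r(v):=\sum_{j=0}^{2r}\frac{(2j+2r-1)!!}{j!}\left(\frac{v^2}{v+1}\right)^{j+r}\sum_{i=j}^{2r}\hat B_{i,j}(\ell_3(v),\ell_4(v),\dots)f^{(\beta)}_{2r-i}(v),$$ with $(-1)!!=1$, $A^{(\beta)}_{-1}:=0$. Then $\tau_r(w):=2^{-r-1}\big(2A^{(5/4)}_r(w)-3w\,A^{(1/4)}_{r-1}(w)\big)$. *)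

theory Defs
  imports
    "HOL-Analysis.Analysis"
    "HOL-Library.Landau_Symbols"
    "HOL-Computational_Algebra.Formal_Power_Series"
    "HOL-Computational_Algebra.Polynomial"
begin

text \<open>The principal branch of the Lambert function; the value is unspecified for
  arguments below \<open>- exp (- 1)\<close>.\<close>

definition lambert_W :: "real \<Rightarrow> real" where
  "lambert_W x = (THE w. - 1 \<le> w \<and> w * exp w = x)"

definition theta :: "real \<Rightarrow> real" where
  "theta t = (\<Sum>\<^sub>\<infinity>k::int. exp (- pi * (of_int k)\<^sup>2 * t))"

definition omega :: "real \<Rightarrow> real" where
  "omega t = 1 / 2 * (3 * t * deriv theta t + 2 * t\<^sup>2 * deriv (deriv theta) t)"

definition Phi :: "real \<Rightarrow> real" where
  "Phi x = 2 * exp (x / 2) * omega (exp (2 * x))"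

text \<open>\<open>turan_b n\<close> is the coefficient \<open>b\<close> with index \<open>2 n\<close> in the Hermite expansion of the
  Riemann \<open>\<Xi>\<close> function, given by its integral formula.\<close>

definition turan_b :: "nat \<Rightarrow> real" where
  "turan_b n = 1 / (2 powi (2 * int n - 1) * fact (2 * n)) *
     (LBINT x:{0..}. x ^ (2 * n) * exp (- x\<^sup>2 / 4) * Phi x)"

text \<open>\<open>bell_hat p i j\<close> is the coefficient of \<open>x\<^sup>i\<close> in \<open>(p 1 * x + p 2 * x\<^sup>2 + \<dots>)\<^sup>j\<close>;
  the value \<open>p 0\<close> is not used.\<close>

definition bell_hat :: "(nat \<Rightarrow> real) \<Rightarrow> nat \<Rightarrow> nat \<Rightarrow> real" where
  "bell_hat p i j = fps_nth (Abs_fps (\<lambda>m. if m = 0 then 0 else p m) ^ j) i"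

definition log_coeff :: "nat \<Rightarrow> real" where
  "log_coeff m = (- 1) ^ (m + 1) / real m"

definition ell :: "nat \<Rightarrow> real \<Rightarrow> real" where
  "ell i u = (\<Sum>j=1..i. bell_hat log_coeff i j * ((- 1) ^ (j + 1) / (real j * u ^ j)))"

definition p_coeff :: "nat \<Rightarrow> real \<Rightarrow> real" where
  "p_coeff i v = (\<Sum>j=0..i. 1 / fact j * (- v / 8) ^ j * bell_hat log_coeff i j)"

definition q_coeff :: "nat \<Rightarrow> real" where
  "q_coeff i = (\<Sum>j=0..i div 2. 1 / fact j * (- 1 / 16) ^ j * bell_hat log_coeff i (2 * j))"

definition f_coeff :: "real \<Rightarrow> nat \<Rightarrow> real \<Rightarrow> real" where
  "f_coeff \<beta> m v = (\<Sum>(j1, j2, j3) \<in> {(j1, j2, j3). j1 + j2 + j3 = m}.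
     (\<beta> gchoose j1) * p_coeff j2 v * q_coeff j3)"

text \<open>\<open>odd_dfact m = (2 m - 1)!!\<close>, with \<open>(- 1)!! = 1\<close>.\<close>

definition odd_dfact :: "nat \<Rightarrow> real" where
  "odd_dfact m = (\<Prod>i<m. 2 * real i + 1)"

definition A_coeff :: "real \<Rightarrow> nat \<Rightarrow> real \<Rightarrow> real" where
  "A_coeff \<beta> r v = (\<Sum>j=0..2 * r. odd_dfact (j + r) / fact j * (v\<^sup>2 / (v + 1)) ^ (j + r) *
     (\<Sum>i=j..2 * r. bell_hat (\<lambda>m. ell (m + 2) v) i j * f_coeff \<beta> (2 * r - i) v))"

definition tau :: "nat \<Rightarrow> real \<Rightarrow> real" where
  "tau r w = 1 / 2 ^ (r + 1) *
     (2 * A_coeff (5 / 4) r w - 3 * w * (if r = 0 then 0 else A_coeff (1 / 4) (r - 1) w))"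

end

theory Submission
  imports Defs "HOL-Complex_Analysis.Complex_Analysis" "HOL-Probability.Probability"
    "HOL-Real_Asymp.Real_Asymp"
begin

text \<open>
  Only the first summand of the theta series matters. Put \<open>M = 2 n = \<pi> w e\<^sup>w\<close>. The substitution
  \<open>e\<^sup>2\<^sup>x = e\<^sup>w (1 + z)\<close> moves the saddle point to \<open>z = 0\<close>, and near it the integrand is the Gaussian
  \<open>exp (- M (w + 1) z\<^sup>2 / (2 w\<^sup>2))\<close> times \<open>h(s, z) = exp (s \<psi>(z)) g(z)\<close> with \<open>s = M z\<^sup>2\<close>. For fixed \<open>s\<close>
  the Taylor coefficients of \<open>h(s, z)\<close> in \<open>z\<close> are polynomials in \<open>s\<close>, and integrating the Taylor
  polynomial of degree below \<open>2 K\<close>, with \<open>s = M z\<^sup>2\<close>, against the Gaussian gives exactly the sum of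
  \<open>A_coeff \<beta> r w / M\<^sup>r\<close> over \<open>r < K\<close>. Since \<open>|\<psi>| \<le> 64 / w\<^sup>2\<close> and \<open>g = O(1)\<close> on the disc of radius
  \<open>1 / (2 w)\<close>, the Cauchy estimates bound both the Taylor remainder inside \<open>|z| \<le> 1 / (4 w)\<close> and the Taylor
  polynomial outside by a multiple of \<open>exp (64 s / w\<^sup>2) (w z)\<^sup>2\<^sup>K\<close>, whose Gaussian integral is of relative
  size \<open>(w\<^sup>3 / M)\<^sup>K\<close>. Everything else is smaller than any power of \<open>e\<^sup>-\<^sup>w\<close>.
\<close>

section \<open>Power series with real coefficients and Cauchy estimates\<close>

text \<open>Two scales compete. The Gaussian has width about sqrt(w/M), which shrinks exponentially
  in \<open>w\<close>, whereas the amplitude contains (1 + z)^(-w/8) and is under control only for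
  |z| of order 1/w; this dictates the disc. On that disc M z^2 psi(z) is only bounded by a multiple
  of M/w^4, so a Cauchy estimate for exp(M z^2 psi(z)) g(z), taken as a function of z alone, would
  lose a factor exponential in M/w^4. Freezing s = M z^2 as an independent nonnegative parameter
  avoids this: only psi has to be bounded, and the loss exp(64 s / w^2) is paid by the Gaussian once
  s is put back. The payment is possible because (w + 1)/(2 w^2) - 64/w^2 >= 1/(4 w), which is the
  origin of the threshold 256. The coefficients in question are real by definition but the estimates
  are complex, hence the passage through \<open>complex_fps\<close>.\<close>

definition complex_fps :: "real fps \<Rightarrow> complex fps" where
  "complex_fps F = Abs_fps (\<lambda>n. complex_of_real (fps_nth F n))"

lemma complex_fps_nth [simp]: "fps_nth (complex_fps F) n = complex_of_real (fps_nth F n)"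
  by (simp add: complex_fps_def)

lemma complex_fps_mult: "complex_fps (F * G) = complex_fps F * complex_fps G"
  by (simp add: fps_eq_iff fps_mult_nth)

lemma complex_fps_one: "complex_fps 1 = 1"
  by (simp add: fps_eq_iff fps_one_def)

lemma complex_fps_power: "complex_fps (F ^ n) = complex_fps F ^ n"
  by (induction n) (simp_all add: complex_fps_one complex_fps_mult)

lemma complex_fps_compose: "complex_fps (F oo G) = complex_fps F oo complex_fps G"
  by (simp add: fps_eq_iff fps_compose_nth flip: complex_fps_power)

lemma complex_fps_const: "complex_fps (fps_const c) = fps_const (complex_of_real c)"
  by (simp add: fps_eq_iff fps_const_def)

lemma complex_fps_exp: "complex_fps (fps_exp c) = fps_exp (complex_of_real c)"
  by (simp add: fps_eq_iff)

lemma complex_fps_ln: "complex_fps (fps_ln 1) = fps_ln 1"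
  by (simp add: fps_eq_iff fps_ln_nth)

lemma complex_fps_binomial: "complex_fps (fps_binomial \<beta>) = fps_binomial (complex_of_real \<beta>)"
  by (simp add: fps_eq_iff gbinomial_prod_rev)

lemma has_fps_expansion_Ln: "(\<lambda>z. Ln (1 + z)) has_fps_expansion fps_ln 1"
proof -
  have s: "(\<lambda>n. fps_nth (fps_ln 1) n * z ^ n) sums Ln (1 + z)" if "norm z < 1" for z :: complex
  proof -
    have "fps_nth (fps_ln 1) n * z ^ n = - ((- z) ^ n) / of_nat n" for n
      by (cases n) (auto simp: fps_ln_nth power_minus[of z])
    with Ln_series'[OF that] show ?thesis by simp
  qed
  have "(1::ereal) \<le> fps_conv_radius (fps_ln 1 :: complex fps)"
    unfolding fps_conv_radius_def
  proof (rule conv_radius_geI_ex')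
    fix r :: real assume "0 < r" "ereal r < 1"
    thus "summable (\<lambda>n. fps_nth (fps_ln 1) n * complex_of_real r ^ n)"
      using s[of "of_real r"] by (simp add: sums_iff)
  qed
  hence "fps_conv_radius (fps_ln 1 :: complex fps) > 0"
    by (rule less_le_trans[rotated]) auto
  moreover have "eventually (\<lambda>z. eval_fps (fps_ln 1) z = Ln (1 + z)) (nhds 0)"
  proof -
    have "eventually (\<lambda>z::complex. z \<in> ball 0 1) (nhds 0)"
      by (intro eventually_nhds_in_open) auto
    thus ?thesis
      by eventually_elim (use s in \<open>auto simp: eval_fps_def sums_iff\<close>)
  qed
  ultimately show ?thesis by (simp add: has_fps_expansion_def)
qed

lemma cauchy_fps_nth_bound:
  fixes h :: "complex \<Rightarrow> complex"
  assumes "h has_fps_expansion F" "h holomorphic_on cball 0 r" "r > 0"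
    and "\<And>z. norm z \<le> r \<Longrightarrow> norm (h z) \<le> B"
  shows "norm (fps_nth F n) \<le> B / r ^ n"
proof -
  have "norm ((deriv ^^ n) h 0) \<le> fact n * B / r ^ n"
    using assms by (intro Cauchy_inequality holomorphic_on_imp_continuous_on)
      (auto intro: holomorphic_on_subset)
  thus ?thesis
    by (simp add: fps_nth_fps_expansion[OF assms(1)] norm_divide field_simps)
qed

lemma fps_expansion_sums:
  fixes h :: "complex \<Rightarrow> complex"
  assumes "h has_fps_expansion F" "h holomorphic_on ball 0 r" "norm z < r"
  shows "(\<lambda>n. fps_nth F n * z ^ n) sums h z"
  using holomorphic_power_series[OF assms(2), of z] assms(3)
  by (simp add: fps_nth_fps_expansion[OF assms(1)])

text \<open>Cauchy's coefficient bound dominates the tail from index \<open>m\<close> on by a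
  geometric series whose ratio \<open>norm z / r\<close> is at most 1/2; summing it costs the factor
  2.\<close>

lemma cauchy_taylor_bound:
  fixes h :: "complex \<Rightarrow> complex"
  assumes h: "h has_fps_expansion F" "h holomorphic_on cball 0 r" "r > 0"
    and B: "\<And>z. norm z \<le> r \<Longrightarrow> norm (h z) \<le> B" and z: "norm z \<le> r / 2"
  shows "norm (h z - (\<Sum>i<m. fps_nth F i * z ^ i)) \<le> 2 * B * (norm z / r) ^ m"
proof -
  have hb: "h holomorphic_on ball 0 r" by (rule holomorphic_on_subset[OF h(2)]) auto
  have B0: "0 \<le> B" using \<open>r > 0\<close> by (intro order_trans[OF norm_ge_zero B[of 0]]) simp
  define q where "q = norm z / r"
  have q: "0 \<le> q" "q \<le> 1/2" using z \<open>r > 0\<close> by (auto simp: q_def field_simps)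
  have bound: "norm (fps_nth F n * z ^ n) \<le> B * q ^ n" for n
  proof -
    have "norm (fps_nth F n) * norm z ^ n \<le> B / r ^ n * norm z ^ n"
      by (intro mult_right_mono cauchy_fps_nth_bound[OF h B]) auto
    thus ?thesis by (simp add: q_def norm_mult norm_power power_divide)
  qed
  have "(\<lambda>n. fps_nth F n * z ^ n) sums h z"
    using z \<open>r > 0\<close> by (intro fps_expansion_sums[OF h(1) hb]) auto
  hence "(\<lambda>n. fps_nth F (n + m) * z ^ (n + m)) sums (h z - (\<Sum>i<m. fps_nth F i * z ^ i))"
    by (rule sums_split_initial_segment)
  moreover have "(\<lambda>n. (B * q ^ m) * q ^ n) sums ((B * q ^ m) * (1 / (1 - q)))"
    using q by (intro sums_mult geometric_sums) auto
  ultimately have "norm (h z - (\<Sum>i<m. fps_nth F i * z ^ i)) \<le> (B * q ^ m) * (1 / (1 - q))"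
  proof (rule norm_sums_le)
    show "norm (fps_nth F (n + m) * z ^ (n + m)) \<le> B * q ^ m * q ^ n" for n
      using bound[of "n + m"] by (simp add: power_add mult_ac)
  qed
  also have "\<dots> \<le> (B * q ^ m) * 2"
    using q B0 by (intro mult_left_mono) (auto simp: field_simps)
  finally show ?thesis by (simp add: q_def mult_ac)
qed

lemma log_coeff_fps: "Abs_fps (\<lambda>m. if m = 0 then 0 else log_coeff m) = fps_ln 1"
proof (rule fps_ext)
  fix n show "fps_nth (Abs_fps (\<lambda>m. if m = 0 then 0 else log_coeff m)) n = fps_nth (fps_ln 1) n"
    by (cases n) (auto simp: fps_ln_nth log_coeff_def)
qed

lemma bell_hat_log_coeff: "bell_hat log_coeff i j = fps_nth (fps_ln 1 ^ j) i"
  by (simp add: bell_hat_def log_coeff_fps)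

text \<open>The sum over \<open>j\<close> is composition with the outer logarithm, so the
  \<open>ell i u\<close> are the Taylor coefficients of log(1 + log(1 + z)/u). This is log(2x/u)
  when e^(2x) = e^u (1 + z).\<close>

lemma ell_fps: "Abs_fps (\<lambda>i. ell i u) = fps_ln 1 oo (fps_const (1 / u) * fps_ln 1)"
proof (rule fps_ext)
  fix i
  have "fps_nth (fps_ln 1 oo (fps_const (1 / u) * fps_ln 1)) i =
        (\<Sum>j=0..i. fps_nth (fps_ln 1) j * ((1 / u) ^ j * fps_nth (fps_ln 1 ^ j) i))"
    by (simp add: fps_compose_nth power_mult_distrib fps_const_power)
  also have "\<dots> = (\<Sum>j=1..i. fps_nth (fps_ln 1) j * ((1 / u) ^ j * fps_nth (fps_ln 1 ^ j) i))"
    by (intro sum.mono_neutral_right) (auto simp: not_le)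
  also have "\<dots> = ell i u"
    unfolding ell_def
  proof (rule sum.cong)
    fix j assume "j \<in> {1..i}"
    thus "fps_nth (fps_ln 1) j * ((1 / u) ^ j * fps_nth (fps_ln 1 ^ j) i) =
          bell_hat log_coeff i j * ((- 1) ^ (j + 1) / (real j * u ^ j))"
      by (cases j) (auto simp: fps_ln_nth bell_hat_log_coeff field_simps)
  qed simp
  finally show "fps_nth (Abs_fps (\<lambda>i. ell i u)) i = fps_nth (fps_ln 1 oo (fps_const (1 / u) * fps_ln 1)) i"
    by simp
qed

text \<open>The coefficient 1/u cancels against z/w in the phase, which is the saddle point
  condition, and the quadratic coefficient becomes the Gaussian exponent; only orders from three on
  are left for \<open>psi_fps\<close>.\<close>

lemma ell_low: 
  assumes "u \<noteq> 0"
  shows "ell 0 u = 0" "ell 1 u = 1 / u" "ell 2 u = - (u + 1) / (2 * u\<^sup>2)"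
proof -
  show "ell 0 u = 0" by (simp add: ell_def)
  show "ell 1 u = 1 / u" by (simp add: ell_def bell_hat_log_coeff fps_ln_nth)
  have "{1..2::nat} = {1,2}" by auto
  thus "ell 2 u = - (u + 1) / (2 * u\<^sup>2)"
    using assms
    by (simp add: ell_def bell_hat_log_coeff fps_ln_nth power2_eq_square fps_mult_nth numeral_2_eq_2
        field_simps)
qed

section \<open>Taylor expansion at the saddle point\<close>

text \<open>Orders three and up of the phase, divided by z^2, so that the non-Gaussian part of the
  exponent is s psi(z) with s = M z^2. The zero constant term agrees with the convention that
  \<open>bell_hat\<close> ignores \<open>p 0\<close>.\<close>

definition psi_fps :: "real \<Rightarrow> real fps" where
  "psi_fps w = Abs_fps (\<lambda>m. if m = 0 then 0 else ell (m + 2) w)"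

text \<open>The second bracket is (1 + z)^\<beta> (1 + z)^(-w/8) exp(-log(1 + z)^2/16). Its last two
  factors are exp(-x^2/4) at x = (w + log(1 + z))/2, up to the constant exp(-w^2/16).\<close>

definition saddle_fps :: "real \<Rightarrow> real \<Rightarrow> real \<Rightarrow> real fps" where
  "saddle_fps \<beta> w s = (fps_exp s oo psi_fps w) *
     (fps_binomial \<beta> * (fps_exp (- w / 8) oo fps_ln 1) * (fps_exp (- 1 / 16) oo fps_ln 1 ^ 2))"

lemma fps_ln_power_nth_eq_0: "i < j \<Longrightarrow> fps_nth (fps_ln c ^ j) i = 0"
  by (simp add: startsby_zero_power_prefix)

lemma p_coeff_fps: "p_coeff i v = fps_nth (fps_exp (- v / 8) oo fps_ln 1) i"
  by (simp add: p_coeff_def fps_compose_nth bell_hat_log_coeff)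

lemma q_coeff_fps: "q_coeff i = fps_nth (fps_exp (- 1 / 16) oo fps_ln 1 ^ 2) i"
proof -
  have "fps_nth (fps_exp (- 1 / 16) oo fps_ln 1 ^ 2) i =
        (\<Sum>j=0..i. (- 1 / 16) ^ j / fact j * fps_nth (fps_ln (1::real) ^ (2 * j)) i)"
    by (simp add: fps_compose_nth power_mult)
  \<comment> \<open>The series \<open>fps_ln 1 ^ (2 * j)\<close> starts at order 2j, so nothing is
    lost by stopping at \<open>i div 2\<close>.\<close>
  also have "\<dots> = (\<Sum>j=0..i div 2. (- 1 / 16) ^ j / fact j * fps_nth (fps_ln 1 ^ (2 * j)) i)"
    by (intro sum.mono_neutral_right) (auto simp: fps_ln_power_nth_eq_0)
  finally show ?thesis
    by (simp add: q_coeff_def bell_hat_log_coeff)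
qed

lemma f_coeff_fps:
  "f_coeff \<beta> m v = fps_nth (fps_binomial \<beta> * (fps_exp (- v / 8) oo fps_ln 1) *
     (fps_exp (- 1 / 16) oo fps_ln 1 ^ 2)) m"
proof -
  have "f_coeff \<beta> m v = (\<Sum>(k, j) \<in> (SIGMA k:{0..m}. {0..k}).
     (\<beta> gchoose j) * p_coeff (k - j) v * q_coeff (m - k))"
    unfolding f_coeff_def
    by (rule sum.reindex_bij_witness[of _ "\<lambda>(k, j). (j, k - j, m - k)" "\<lambda>(j1, j2, j3). (j1 + j2, j1)"])
       auto
  also have "\<dots> = (\<Sum>k=0..m. \<Sum>j=0..k. (\<beta> gchoose j) * p_coeff (k - j) v * q_coeff (m - k))"
    by (subst sum.Sigma) auto
  finally show ?thesis
    by (simp add: fps_mult_nth p_coeff_fps q_coeff_fps sum_distrib_right)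
qed

lemma saddle_fps_nth:
  "fps_nth (saddle_fps \<beta> w s) i =
     (\<Sum>k=0..i. (\<Sum>j=0..k. s ^ j / fact j * bell_hat (\<lambda>m. ell (m + 2) w) k j) * f_coeff \<beta> (i - k) w)"
  unfolding saddle_fps_def f_coeff_fps bell_hat_def psi_fps_def[symmetric]
    fps_mult_nth[of "fps_exp s oo psi_fps w"] fps_compose_nth[of "fps_exp s"] by simp

section \<open>The holomorphic functions behind the formal series\<close>

definition loglog :: "real \<Rightarrow> complex \<Rightarrow> complex" where
  "loglog w z = Ln (1 + Ln (1 + z) / of_real w)"

lemma loglog_fps:
  assumes "w > 0"
  shows "loglog w has_fps_expansion complex_fps (Abs_fps (\<lambda>i. ell i w))"
proof -
  have "((\<lambda>z. Ln (1 + z)) \<circ> (\<lambda>z. of_real (1 / w) * Ln (1 + z))) has_fps_expansion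
      (fps_ln 1 oo (fps_const (of_real (1 / w)) * fps_ln 1))"
    by (intro has_fps_expansion_compose has_fps_expansion_Ln has_fps_expansion_cmult_left) auto
  also have "((\<lambda>z. Ln (1 + z)) \<circ> (\<lambda>z. of_real (1 / w) * Ln (1 + z))) = loglog w"
    by (auto simp: loglog_def fun_eq_iff)
  finally show ?thesis
    by (simp add: ell_fps complex_fps_compose complex_fps_mult complex_fps_const complex_fps_ln)
qed

lemma Re_pos_of_norm_less_1: "norm (z::complex) < 1 \<Longrightarrow> 0 < Re (1 + z)"
  using abs_Re_le_cmod[of z] by auto

lemma one_plus_notin_nonpos: "norm (z::complex) < 1 \<Longrightarrow> 1 + z \<notin> \<real>\<^sub>\<le>\<^sub>0"
  using Re_pos_of_norm_less_1[of z] by (auto simp: complex_nonpos_Reals_iff)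

lemma norm_Ln_div_le:
  assumes "w \<ge> 4" "norm z \<le> 1/4"
  shows "norm (Ln (1 + z) / complex_of_real w) \<le> 1 / (2 * w)" "1 / (2 * w) < 1/2"
proof -
  have "norm (Ln (1 + z)) \<le> 2 * norm z" using assms by (intro norm_Ln_le) auto
  also have "\<dots> \<le> 1/2" using assms by auto
  finally show "norm (Ln (1 + z) / complex_of_real w) \<le> 1 / (2 * w)"
    using assms by (auto simp: norm_divide field_simps)
  show "1 / (2 * w) < 1/2" using assms by (auto simp: field_simps)
qed

lemma loglog_holomorphic:
  assumes "w \<ge> 4"
  shows "loglog w holomorphic_on cball 0 (1/4)"
  unfolding loglog_def
proof (intro holomorphic_intros)
  fix z :: complex assume z: "z \<in> cball 0 (1/4)"
  show "1 + z \<notin> \<real>\<^sub>\<le>\<^sub>0" using z by (intro one_plus_notin_nonpos) auto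
  show "1 + Ln (1 + z) / complex_of_real w \<notin> \<real>\<^sub>\<le>\<^sub>0"
    using z norm_Ln_div_le[OF assms, of z] by (intro one_plus_notin_nonpos) auto
qed (use assms in auto)

text \<open>Cauchy's estimate on the disc of radius 1/4: applying |Ln(1 + u)| <= 2|u| to both
  logarithms bounds the function by 1/w. This decay in \<open>w\<close> is what later makes psi
  small against the Gaussian exponent.\<close>

lemma ell_bound:
  assumes "w \<ge> 4"
  shows "\<bar>ell i w\<bar> \<le> 4 ^ i / w"
proof -
  have "norm (fps_nth (complex_fps (Abs_fps (\<lambda>i. ell i w))) i) \<le> (1 / w) / (1/4) ^ i"
  proof (rule cauchy_fps_nth_bound[OF loglog_fps loglog_holomorphic])
    fix z :: complex assume z: "norm z \<le> 1/4"
    have "norm (loglog w z) \<le> 2 * norm (Ln (1 + z) / complex_of_real w)"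
      unfolding loglog_def using norm_Ln_div_le[OF assms z] by (intro norm_Ln_le) auto
    also have "\<dots> \<le> 2 * (1 / (2 * w))" using norm_Ln_div_le[OF assms z] by (intro mult_left_mono) auto
    finally show "norm (loglog w z) \<le> 1 / w" by simp
  qed (use assms in auto)
  thus ?thesis by (simp add: power_divide)
qed

text \<open>Summing the series, instead of dividing the phase by z^2, gives holomorphy at 0 without
  a removable singularity; \<open>loglog_eq_cpsi\<close> recovers the quotient.\<close>

definition cpsi :: "real \<Rightarrow> complex \<Rightarrow> complex" where
  "cpsi w = eval_fps (complex_fps (psi_fps w))"

lemma psi_fps_bound:
  assumes "w \<ge> 4"
  shows "norm (fps_nth (psi_fps w) m) \<le> (if m = 0 then 0 else 16 / w * 4 ^ m)"
  using ell_bound[OF assms, of "m + 2"] by (auto simp: psi_fps_def power_add)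

lemma psi_conv_radius:
  assumes "w \<ge> 4"
  shows "fps_conv_radius (complex_fps (psi_fps w)) \<ge> ereal (1/4)"
  unfolding fps_conv_radius_def
proof (rule conv_radius_geI_ex')
  fix r :: real assume r: "0 < r" "ereal r < ereal (1/4)"
  have r4: "4 * r < 1" using r by simp
  show "summable (\<lambda>n. fps_nth (complex_fps (psi_fps w)) n * complex_of_real r ^ n)"
  proof (rule summable_comparison_test[OF _ summable_mult[OF summable_geometric]])
    show "norm (4 * r) < 1" using r r4 by simp
    have "norm (fps_nth (complex_fps (psi_fps w)) n * complex_of_real r ^ n) \<le> 16 / w * (4 * r) ^ n" for n
    proof -
      have "norm (fps_nth (psi_fps w) n) * r ^ n \<le> (16 / w * 4 ^ n) * r ^ n"
        using psi_fps_bound[OF assms, of n] r assms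
        by (intro mult_right_mono order_trans[OF psi_fps_bound[OF assms, of n]]) (auto split: if_splits)
      thus ?thesis using r by (simp add: norm_mult norm_power power_mult_distrib mult_ac)
    qed
    thus "\<exists>N. \<forall>n\<ge>N. norm (fps_nth (complex_fps (psi_fps w)) n * complex_of_real r ^ n) \<le> 16 / w * (4 * r) ^ n"
      by auto
  qed
qed

lemma cpsi_sums:
  assumes "w \<ge> 4" "norm z < 1/4"
  shows "(\<lambda>m. fps_nth (complex_fps (psi_fps w)) m * z ^ m) sums cpsi w z"
  unfolding cpsi_def
proof (rule sums_eval_fps)
  have "ereal (norm z) < ereal (1/4)" using assms by simp
  also note psi_conv_radius[OF assms(1)]
  finally show "ereal (norm z) < fps_conv_radius (complex_fps (psi_fps w))" .
qed

lemma cpsi_fps: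
  assumes "w \<ge> 4"
  shows "cpsi w has_fps_expansion complex_fps (psi_fps w)"
  unfolding cpsi_def
  using psi_conv_radius[OF assms]
  by (intro eval_fps_has_fps_expansion) (rule less_le_trans[rotated], auto)

lemma cpsi_holomorphic:
  assumes "w \<ge> 4"
  shows "cpsi w holomorphic_on ball 0 (1/4)"
  unfolding cpsi_def
proof (rule holomorphic_on_eval_fps, rule subsetI)
  fix z :: complex assume "z \<in> ball 0 (1/4)"
  hence "ereal (norm z) < ereal (1/4)" by simp
  also note psi_conv_radius[OF assms(1)]
  finally show "z \<in> eball 0 (fps_conv_radius (complex_fps (psi_fps w)))" by (simp add: in_eball_iff)
qed

text \<open>The constant term of psi vanishes, so the geometric majorant starts at index 1 and keeps
  a factor |z|. With 4|z| <= 1/2 the sum costs a factor 2, hence 128 = 16 * 4 * 2.\<close>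

lemma cpsi_bound:
  assumes "w \<ge> 4" "norm z \<le> 1/8"
  shows "norm (cpsi w z) \<le> 128 * norm z / w"
proof -
  define q where "q = 4 * norm z"
  have q: "0 \<le> q" "q \<le> 1/2" using assms by (auto simp: q_def)
  have "(\<lambda>m. fps_nth (complex_fps (psi_fps w)) (m + 1) * z ^ (m + 1)) sums
      (cpsi w z - (\<Sum>i<1. fps_nth (complex_fps (psi_fps w)) i * z ^ i))"
    using assms by (intro sums_split_initial_segment cpsi_sums) auto
  hence "(\<lambda>m. fps_nth (complex_fps (psi_fps w)) (m + 1) * z ^ (m + 1)) sums cpsi w z"
    by (simp add: psi_fps_def)
  moreover have "(\<lambda>n. (16 / w * q) * q ^ n) sums ((16 / w * q) * (1 / (1 - q)))"
    using q by (intro sums_mult geometric_sums) auto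
  ultimately have "norm (cpsi w z) \<le> (16 / w * q) * (1 / (1 - q))"
  proof (rule norm_sums_le)
    fix n
    have "norm (fps_nth (psi_fps w) (n + 1)) * norm z ^ (n + 1) \<le> (16 / w * 4 ^ (n + 1)) * norm z ^ (n + 1)"
      using psi_fps_bound[OF assms(1), of "n + 1"] by (intro mult_right_mono) auto
    thus "norm (fps_nth (complex_fps (psi_fps w)) (n + 1) * z ^ (n + 1)) \<le> 16 / w * q * q ^ n"
      by (simp add: norm_mult norm_power q_def power_mult_distrib mult_ac)
  qed
  also have "\<dots> \<le> (16 / w * q) * 2"
    using q assms by (intro mult_left_mono) (auto simp: field_simps)
  finally show ?thesis by (simp add: q_def)
qed

lemma loglog_eq_cpsi:
  assumes "w \<ge> 4" "norm z < 1/4"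
  shows "z\<^sup>2 * cpsi w z = loglog w z - z / of_real w + of_real ((w + 1) / (2 * w\<^sup>2)) * z\<^sup>2"
proof -
  let ?F = "complex_fps (Abs_fps (\<lambda>i. ell i w))"
  have "(\<lambda>n. fps_nth ?F n * z ^ n) sums loglog w z"
    using assms by (intro fps_expansion_sums[OF loglog_fps, of w "1/4"]
        holomorphic_on_subset[OF loglog_holomorphic]) auto
  hence 1: "(\<lambda>n. fps_nth ?F (n + 3) * z ^ (n + 3)) sums (loglog w z - (\<Sum>i<3. fps_nth ?F i * z ^ i))"
    by (rule sums_split_initial_segment)
  have "(\<lambda>m. fps_nth (complex_fps (psi_fps w)) (m + 1) * z ^ (m + 1)) sums
      (cpsi w z - (\<Sum>i<1. fps_nth (complex_fps (psi_fps w)) i * z ^ i))"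
    using assms by (intro sums_split_initial_segment cpsi_sums) auto
  hence "(\<lambda>m. z\<^sup>2 * (fps_nth (complex_fps (psi_fps w)) (m + 1) * z ^ (m + 1))) sums (z\<^sup>2 * cpsi w z)"
    by (intro sums_mult) (simp add: psi_fps_def)
  \<comment> \<open>Index m + 1 of psi meets index m + 3 of \<open>ell\<close>: the factor z^2
    accounts for the shift by two.\<close>
  also have "(\<lambda>m. z\<^sup>2 * (fps_nth (complex_fps (psi_fps w)) (m + 1) * z ^ (m + 1))) =
      (\<lambda>n. fps_nth ?F (n + 3) * z ^ (n + 3))"
    by (auto simp: psi_fps_def power_add eval_nat_numeral fun_eq_iff)
  finally have "z\<^sup>2 * cpsi w z = loglog w z - (\<Sum>i<3. fps_nth ?F i * z ^ i)"
    using 1 sums_unique2 by blast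
  also have "(\<Sum>i<3. fps_nth ?F i * z ^ i) = z / of_real w - of_real ((w + 1) / (2 * w\<^sup>2)) * z\<^sup>2"
    using assms ell_low[of w] by (simp add: eval_nat_numeral) (simp add: field_simps)
  finally show ?thesis by simp
qed

definition csaddle :: "real \<Rightarrow> real \<Rightarrow> real \<Rightarrow> complex \<Rightarrow> complex" where
  "csaddle \<beta> w s z = exp (of_real s * cpsi w z) * ((1 + z) powr of_real \<beta> *
     exp (of_real (- w / 8) * Ln (1 + z)) * exp (of_real (- 1 / 16) * Ln (1 + z) ^ 2))"

lemma csaddle_fps:
  assumes "w \<ge> 4"
  shows "csaddle \<beta> w s has_fps_expansion complex_fps (saddle_fps \<beta> w s)"
proof -
  have e: "(\<lambda>z. exp (of_real c * g z)) has_fps_expansion (fps_exp (of_real c) oo G)"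
    if "g has_fps_expansion G" "fps_nth G 0 = 0" for g :: "complex \<Rightarrow> complex" and G c
    using has_fps_expansion_compose[OF has_fps_expansion_exp[of "of_real c"] that]
    by (simp add: o_def)
  have "(\<lambda>z. exp (of_real s * cpsi w z) * ((1 + z) powr of_real \<beta> *
       exp (of_real (- w / 8) * Ln (1 + z)) * exp (of_real (- 1 / 16) * Ln (1 + z) ^ 2)))
     has_fps_expansion (fps_exp (of_real s) oo complex_fps (psi_fps w)) *
       (fps_binomial (of_real \<beta>) * (fps_exp (of_real (- w / 8)) oo fps_ln 1) *
        (fps_exp (of_real (- 1 / 16)) oo fps_ln 1 ^ 2))"
    by (intro has_fps_expansion_mult e cpsi_fps assms has_fps_expansion_binomial_complex
        has_fps_expansion_power has_fps_expansion_Ln)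
       (auto simp: psi_fps_def)
  also have "(fps_exp (of_real s) oo complex_fps (psi_fps w)) *
       (fps_binomial (of_real \<beta>) * (fps_exp (of_real (- w / 8)) oo fps_ln 1) *
        (fps_exp (of_real (- 1 / 16)) oo fps_ln 1 ^ 2)) = complex_fps (saddle_fps \<beta> w s)"
    by (simp only: saddle_fps_def complex_fps_mult complex_fps_compose complex_fps_exp
        complex_fps_binomial complex_fps_power complex_fps_ln)
  finally show ?thesis by (simp add: csaddle_def[abs_def])
qed

lemma csaddle_holomorphic:
  assumes "w \<ge> 4"
  shows "csaddle \<beta> w s holomorphic_on ball 0 (1/4)"
  unfolding csaddle_def[abs_def]
  using one_plus_notin_nonpos
  by (intro holomorphic_intros cpsi_holomorphic assms) auto

text \<open>The radius 1/(2w) is chosen for exp(-w Ln(1 + z)/8), since it gives w |Ln(1 + z)| <= 1.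
  At the same radius 128|z|/w becomes 64/w^2, and the remaining exponents add up to less than
  |\<beta>| + 1.\<close>

lemma csaddle_bound:
  assumes w: "w \<ge> 4" and s: "s \<ge> 0" and z: "norm z \<le> 1 / (2 * w)"
  shows "norm (csaddle \<beta> w s z) \<le> exp (\<bar>\<beta>\<bar> + 1) * exp (64 * s / w\<^sup>2)"
proof -
  have z8: "norm z \<le> 1/8"
    using z w by (elim order_trans) (auto simp: field_simps)
  have z1: "1 + z \<noteq> 0" using one_plus_notin_nonpos[of z] z8 by auto
  define L where "L = Ln (1 + z)"
  have L: "norm L \<le> 2 * norm z" unfolding L_def using z8 by (intro norm_Ln_le) auto
  have L1: "norm L \<le> 1/4" using L z8 by simp
  have wL: "w * norm L \<le> 1"
  proof -
    have "w * norm L \<le> w * (2 * (1 / (2 * w)))" using L z w by (intro mult_left_mono) auto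
    thus ?thesis using w by simp
  qed
  have "norm (cpsi w z) \<le> 128 * norm z / w" by (rule cpsi_bound[OF w z8])
  also have "\<dots> \<le> 128 * (1 / (2 * w)) / w" using z w by (intro divide_right_mono mult_left_mono) auto
  also have "\<dots> = 64 / w\<^sup>2" by (simp add: power2_eq_square)
  finally have psi: "norm (cpsi w z) \<le> 64 / w\<^sup>2" .
  have "csaddle \<beta> w s z = exp (of_real s * cpsi w z + of_real \<beta> * L + of_real (- w / 8) * L
      + of_real (- 1 / 16) * L ^ 2)"
    unfolding csaddle_def exp_add powr_def L_def[symmetric] using z1 by simp
  also have "norm \<dots> \<le> exp (norm (of_real s * cpsi w z + of_real \<beta> * L + of_real (- w / 8) * L
      + of_real (- 1 / 16) * L ^ 2))"
    by (rule norm_exp)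
  also have "\<dots> \<le> exp (s * (64 / w\<^sup>2) + \<bar>\<beta>\<bar> + 1/8 + 1/16)"
  proof (subst exp_le_cancel_iff)
    have 1: "norm (of_real s * cpsi w z) \<le> s * (64 / w\<^sup>2)"
      using mult_left_mono[OF psi s] s by (simp add: norm_mult)
    have 2: "norm (of_real \<beta> * L) \<le> \<bar>\<beta>\<bar>"
      using L1 mult_left_mono[of "norm L" 1 "\<bar>\<beta>\<bar>"] by (simp add: norm_mult)
    have 3: "norm (of_real (- w / 8) * L) \<le> 1/8"
      using wL w by (simp add: norm_mult)
    have "norm L ^ 2 \<le> 1 ^ 2" using L1 by (intro power_mono) auto
    hence 4: "norm (of_real (- 1 / 16) * L ^ 2) \<le> 1/16"
      by (simp add: norm_mult norm_power)
    show "norm (of_real s * cpsi w z + of_real \<beta> * L + of_real (- w / 8) * L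
      + of_real (- 1 / 16) * L ^ 2) \<le> s * (64 / w\<^sup>2) + \<bar>\<beta>\<bar> + 1/8 + 1/16"
      by (intro norm_triangle_mono 1 2 3 4)
  qed
  also have "\<dots> \<le> exp (\<bar>\<beta>\<bar> + 1) * exp (64 * s / w\<^sup>2)"
    by (subst exp_add[symmetric], subst exp_le_cancel_iff) (simp add: mult_ac)
  finally show ?thesis .
qed

section \<open>Restriction to the real axis\<close>

definition amplitude :: "real \<Rightarrow> real \<Rightarrow> real \<Rightarrow> real" where
  "amplitude \<beta> w z = (1 + z) powr \<beta> * exp (- w / 8 * ln (1 + z) - (ln (1 + z))\<^sup>2 / 16)"

text \<open>With e^(2x) = e^w (1 + z) and M = pi w e^w, M times this is log(x^M exp(-pi e^(2x)))
  minus its value at z = 0. The other factors of the integrand, Jacobian included, form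
  \<open>amplitude\<close>, again divided by their value at z = 0.\<close>

definition phase :: "real \<Rightarrow> real \<Rightarrow> real" where
  "phase w z = ln (1 + ln (1 + z) / w) - z / w"

lemma csaddle_of_real:
  assumes w: "w \<ge> 4" and z: "\<bar>z\<bar> < 1/4"
  shows "csaddle \<beta> w (M * z\<^sup>2) (of_real z) =
    of_real (exp (M * (phase w z + (w + 1) / (2 * w\<^sup>2) * z\<^sup>2)) * amplitude \<beta> w z)"
proof -
  have z1: "1 + z > 0" using z by auto
  have Ln: "Ln (1 + of_real z) = of_real (ln (1 + z))"
    using Ln_of_real[OF z1] by simp
  have pos: "1 + ln (1 + z) / w > 0"
  proof -
    have "norm (Ln (1 + of_real z) / complex_of_real w) \<le> 1 / (2 * w)" "1 / (2 * w) < 1 / 2"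
      using norm_Ln_div_le[of w "of_real z"] assms by auto
    hence "\<bar>ln (1 + z) / w\<bar> < 1" unfolding Ln by (simp add: norm_divide)
    thus ?thesis unfolding abs_less_iff by linarith
  qed
  have "loglog w (of_real z) = Ln (of_real (1 + ln (1 + z) / w))"
    unfolding loglog_def Ln by simp
  also have "\<dots> = of_real (ln (1 + ln (1 + z) / w))" using pos by (rule Ln_of_real)
  finally have ll: "loglog w (of_real z) = of_real (ln (1 + ln (1 + z) / w))" .
  have "of_real (M * z\<^sup>2) * cpsi w (of_real z) = of_real M * ((of_real z)\<^sup>2 * cpsi w (of_real z))"
    by simp
  also have "\<dots> = of_real (M * (phase w z + (w + 1) / (2 * w\<^sup>2) * z\<^sup>2))"
    using w z by (subst loglog_eq_cpsi) (auto simp: ll phase_def)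
  finally have 1: "of_real (M * z\<^sup>2) * cpsi w (of_real z) =
      of_real (M * (phase w z + (w + 1) / (2 * w\<^sup>2) * z\<^sup>2))" .
  have 2: "(1 + complex_of_real z) powr of_real \<beta> = of_real ((1 + z) powr \<beta>)"
    using z1 powr_of_real[of "1 + z" \<beta>] by simp
  have 3: "of_real (- 1 / 16) * complex_of_real (ln (1 + z)) ^ 2 = of_real (- 1 / 16 * (ln (1 + z))\<^sup>2)"
    by simp
  have 4: "- w / 8 * ln (1 + z) - (ln (1 + z))\<^sup>2 / 16 = - w / 8 * ln (1 + z) + (- 1 / 16 * (ln (1 + z))\<^sup>2)"
    by simp
  show ?thesis
    unfolding csaddle_def Ln 1 2 3 amplitude_def 4 exp_add
    by (simp only: of_real_mult[symmetric] exp_of_real mult.assoc)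
qed

text \<open>The function is cut off to 0 outside the short interval while the Taylor polynomial is
  not. One pointwise bound on the whole line then suffices, and the Gaussian moments of the
  polynomial can be taken exactly.\<close>

lemma saddle_taylor_bound:
  fixes K :: nat
  assumes w: "w \<ge> 4" and M: "M \<ge> 0"
  shows "\<bar>(if \<bar>z\<bar> \<le> 1 / (4 * w)
            then exp (M * (phase w z + (w + 1) / (2 * w\<^sup>2) * z\<^sup>2)) * amplitude \<beta> w z else 0) -
          (\<Sum>i<2*K. fps_nth (saddle_fps \<beta> w (M * z\<^sup>2)) i * z ^ i)\<bar>
         \<le> exp (\<bar>\<beta>\<bar> + 1) * real (2 * K + 2) * 16 ^ K * (exp (64 * (M * z\<^sup>2) / w\<^sup>2) * (w * z) ^ (2 * K))"
proof -
  define s where "s = M * z\<^sup>2"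
  have s: "s \<ge> 0" using M by (simp add: s_def)
  define B where "B = exp (\<bar>\<beta>\<bar> + 1) * exp (64 * s / w\<^sup>2)"
  have B: "B \<ge> 0" by (simp add: B_def)
  let ?F = "saddle_fps \<beta> w s"
  define r where "r = 1 / (2 * w)"
  have r: "r > 0" "r \<le> 1/8" using w by (auto simp: r_def field_simps)
  have fps: "csaddle \<beta> w s has_fps_expansion complex_fps ?F" by (rule csaddle_fps[OF w])
  have hol: "csaddle \<beta> w s holomorphic_on cball 0 r"
    using r by (intro holomorphic_on_subset[OF csaddle_holomorphic[OF w]]) auto
  have bd: "norm (csaddle \<beta> w s \<zeta>) \<le> B" if "norm \<zeta> \<le> r" for \<zeta>
    using csaddle_bound[OF w s] that by (simp add: B_def r_def)
  have even: "(w * z) ^ (2 * K) = (w * \<bar>z\<bar>) ^ (2 * K)" by (simp add: power_mult power_mult_distrib)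
  have p16: "(16::real) ^ K = 4 ^ (2 * K)" by (simp add: power_mult)
  show ?thesis
  proof (cases "\<bar>z\<bar> \<le> 1 / (4 * w)")
    case True
    hence z: "\<bar>z\<bar> \<le> r / 2" by (simp add: r_def)
    hence z4: "\<bar>z\<bar> < 1/4" using r by linarith
    let ?h = "exp (M * (phase w z + (w + 1) / (2 * w\<^sup>2) * z\<^sup>2)) * amplitude \<beta> w z"
    have "norm (csaddle \<beta> w s (of_real z) - (\<Sum>i<2*K. fps_nth (complex_fps ?F) i * of_real z ^ i))
        \<le> 2 * B * (norm (complex_of_real z) / r) ^ (2 * K)"
      using z by (intro cauchy_taylor_bound[OF fps hol r(1) bd]) auto
    also have "csaddle \<beta> w s (of_real z) - (\<Sum>i<2*K. fps_nth (complex_fps ?F) i * of_real z ^ i) =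
        of_real (?h - (\<Sum>i<2*K. fps_nth ?F i * z ^ i))"
      unfolding s_def csaddle_of_real[OF w z4] by simp
    also have "norm \<dots> = \<bar>?h - (\<Sum>i<2*K. fps_nth ?F i * z ^ i)\<bar>" by (rule norm_of_real)
    also have "2 * B * (norm (complex_of_real z) / r) ^ (2 * K) = B * 2 * (2 * (w * \<bar>z\<bar>)) ^ (2 * K)"
      by (simp add: r_def mult_ac)
    \<comment> \<open>Weakened so that both cases share one constant; the summand 2 in
      \<open>2 * K + 2\<close> keeps the bound valid for K = 0.\<close>
    also have "\<dots> \<le> B * real (2 * K + 2) * (4 * (w * \<bar>z\<bar>)) ^ (2 * K)"
      using B w by (intro mult_mono power_mono) auto
    also have "\<dots> = exp (\<bar>\<beta>\<bar> + 1) * real (2 * K + 2) * 16 ^ K *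
         (exp (64 * s / w\<^sup>2) * (w * z) ^ (2 * K))"
      unfolding B_def even p16 by (simp only: power_mult_distrib mult_ac)
    finally show ?thesis using True by (simp add: s_def)
  next
    case False
    \<comment> \<open>Cauchy gives the base 2 w |z|. Doubling it makes the base at least 1 here, so
      that all powers below 2K are dominated by the last one.\<close>
    define y where "y = 4 * (w * \<bar>z\<bar>)"
    have y: "y \<ge> 1" using False w by (auto simp: field_simps y_def)
    have "\<bar>\<Sum>i<2*K. fps_nth ?F i * z ^ i\<bar> \<le> (\<Sum>i<2*K. \<bar>fps_nth ?F i * z ^ i\<bar>)" by (rule sum_abs)
    also have "\<dots> \<le> (\<Sum>i<2*K. B * y ^ (2 * K))"
    proof (rule sum_mono)
      fix i assume i: "i \<in> {..<2*K}"
      have "\<bar>fps_nth ?F i\<bar> \<le> B / r ^ i"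
        using cauchy_fps_nth_bound[OF fps hol r(1) bd, of i] by simp
      hence "\<bar>fps_nth ?F i * z ^ i\<bar> \<le> B / r ^ i * \<bar>z\<bar> ^ i"
        unfolding abs_mult power_abs by (intro mult_right_mono) auto
      also have "\<dots> = B * (2 * (w * \<bar>z\<bar>)) ^ i"
        by (simp add: r_def power_divide power_mult_distrib)
      also have "\<dots> \<le> B * y ^ i"
        using B w by (intro mult_left_mono power_mono) (auto simp: y_def)
      also have "\<dots> \<le> B * y ^ (2 * K)"
        using B y i by (intro mult_left_mono power_increasing) auto
      finally show "\<bar>fps_nth ?F i * z ^ i\<bar> \<le> B * y ^ (2 * K)" .
    qed
    also have "\<dots> = B * real (2 * K) * y ^ (2 * K)" by simp
    also have "\<dots> \<le> B * real (2 * K + 2) * y ^ (2 * K)"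
      using B y by (intro mult_right_mono mult_left_mono) auto
    also have "\<dots> = exp (\<bar>\<beta>\<bar> + 1) * real (2 * K + 2) * 16 ^ K *
         (exp (64 * s / w\<^sup>2) * (w * z) ^ (2 * K))"
      unfolding B_def even p16 y_def by (simp only: power_mult_distrib mult_ac)
    finally show ?thesis using False by (simp add: s_def)
  qed
qed

section \<open>Gaussian integration\<close>

lemma odd_dfact_fact: "odd_dfact k = fact (2 * k) / (2 ^ k * fact k)"
proof (induction k)
  case (Suc k)
  have "odd_dfact (Suc k) = fact (2 * k) / (2 ^ k * fact k) * (2 * real k + 1)"
    using Suc by (simp add: odd_dfact_def)
  also have "\<dots> = fact (2 * Suc k) / (2 ^ Suc k * fact (Suc k))"
    by (simp add: divide_simps)
  finally show ?case .
qed (simp add: odd_dfact_def)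

definition gauss_moment :: "real \<Rightarrow> nat \<Rightarrow> real" where
  "gauss_moment \<sigma> p = (if even p then sqrt (2 * pi) * \<sigma> * \<sigma> ^ p * odd_dfact (p div 2) else 0)"

lemma has_bochner_integral_gauss_moment:
  assumes "\<sigma> > 0"
  shows "has_bochner_integral lborel (\<lambda>z. exp (- z\<^sup>2 / (2 * \<sigma>\<^sup>2)) * z ^ p) (gauss_moment \<sigma> p)"
proof -
  have d: "sqrt (2 * pi) * \<sigma> * (normal_density 0 \<sigma> z * (z - 0) ^ p) = exp (- z\<^sup>2 / (2 * \<sigma>\<^sup>2)) * z ^ p" for z
    using assms by (simp add: normal_density_def real_sqrt_mult)
  show ?thesis
  proof (cases "even p")
    case True
    then obtain k where p: "p = 2 * k" by blast
    have v: "sqrt (2 * pi) * \<sigma> * (fact (2 * k) / ((2 / \<sigma>\<^sup>2) ^ k * fact k)) = gauss_moment \<sigma> p"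
      using assms by (simp add: gauss_moment_def p odd_dfact_fact power_divide power_mult)
    have "has_bochner_integral lborel (\<lambda>z. sqrt (2 * pi) * \<sigma> * (normal_density 0 \<sigma> z * (z - 0) ^ (2 * k)))
       (sqrt (2 * pi) * \<sigma> * (fact (2 * k) / ((2 / \<sigma>\<^sup>2) ^ k * fact k)))"
      by (intro has_bochner_integral_mult_right normal_moment_even[OF assms])
    thus ?thesis unfolding v d[unfolded p] by (simp add: p)
  next
    case False
    then obtain k where p: "p = 2 * k + 1" by (auto elim: oddE)
    have "has_bochner_integral lborel (\<lambda>z. sqrt (2 * pi) * \<sigma> * (normal_density 0 \<sigma> z * (z - 0) ^ (2 * k + 1)))
       (sqrt (2 * pi) * \<sigma> * 0)"
      by (intro has_bochner_integral_mult_right normal_moment_odd[OF assms])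
    thus ?thesis unfolding d[unfolded p] using False by (simp add: p gauss_moment_def)
  qed
qed

lemma sum_even_odd: "(\<Sum>i<2 * K. f i) = (\<Sum>r<K. f (2 * r) + f (Suc (2 * r)))" for f :: "nat \<Rightarrow> real"
  by (induction K) (simp_all add: add_ac)

text \<open>The parameter s brings in only even powers of z, so odd Taylor orders integrate to zero
  and order 2r yields the coefficient of index r. The variance turns M^j \<sigma>^(2(j + r)) into
  (w^2/(w + 1))^(j + r) / M^r, which is the shape of \<open>A_coeff\<close>.\<close>

lemma has_bochner_integral_gauss_saddle:
  assumes w: "w > 0" and M: "M > 0" and \<sigma>: "\<sigma> > 0" "\<sigma>\<^sup>2 = w\<^sup>2 / (M * (w + 1))"
  shows "has_bochner_integral lborel
     (\<lambda>z. exp (- z\<^sup>2 / (2 * \<sigma>\<^sup>2)) * (\<Sum>i<2*K. fps_nth (saddle_fps \<beta> w (M * z\<^sup>2)) i * z ^ i))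
     (sqrt (2 * pi) * \<sigma> * (\<Sum>r<K. A_coeff \<beta> r w / M ^ r))"
proof -
  let ?b = "\<lambda>k j. bell_hat (\<lambda>m. ell (m + 2) w) k j"
  let ?c = "\<lambda>i k j. M ^ j / fact j * ?b k j * f_coeff \<beta> (i - k) w"
  define I where "I i = (\<Sum>k=0..i. \<Sum>j=0..k. ?c i k j * gauss_moment \<sigma> (2 * j + i))" for i
  have int: "has_bochner_integral lborel
     (\<lambda>z. exp (- z\<^sup>2 / (2 * \<sigma>\<^sup>2)) * (fps_nth (saddle_fps \<beta> w (M * z\<^sup>2)) i * z ^ i)) (I i)" for i
  proof -
    have "has_bochner_integral lborel
       (\<lambda>z. \<Sum>k=0..i. \<Sum>j=0..k. ?c i k j * (exp (- z\<^sup>2 / (2 * \<sigma>\<^sup>2)) * z ^ (2 * j + i))) (I i)"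
      unfolding I_def
      by (intro has_bochner_integral_sum has_bochner_integral_mult_right has_bochner_integral_gauss_moment \<sigma>)
    also have "(\<lambda>z. \<Sum>k=0..i. \<Sum>j=0..k. ?c i k j * (exp (- z\<^sup>2 / (2 * \<sigma>\<^sup>2)) * z ^ (2 * j + i))) =
       (\<lambda>z. exp (- z\<^sup>2 / (2 * \<sigma>\<^sup>2)) * (fps_nth (saddle_fps \<beta> w (M * z\<^sup>2)) i * z ^ i))"
      unfolding saddle_fps_nth sum_distrib_left sum_distrib_right
      by (intro ext sum.cong) (simp_all add: power_mult_distrib power_add power_mult)
    finally show ?thesis .
  qed
  have odd: "I (Suc (2 * r)) = 0" for r
  proof -
    have "gauss_moment \<sigma> (2 * j + Suc (2 * r)) = 0" for j by (simp add: gauss_moment_def)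
    thus ?thesis unfolding I_def by (simp only: mult_zero_right sum.neutral_const)
  qed
  have even: "I (2 * r) = sqrt (2 * pi) * \<sigma> * (A_coeff \<beta> r w / M ^ r)" for r
  proof -
    have gm: "M ^ j * gauss_moment \<sigma> (2 * j + 2 * r) =
        sqrt (2 * pi) * \<sigma> * odd_dfact (j + r) * (w\<^sup>2 / (w + 1)) ^ (j + r) / M ^ r" for j
    proof -
      have "M ^ j * gauss_moment \<sigma> (2 * j + 2 * r) =
          sqrt (2 * pi) * \<sigma> * odd_dfact (j + r) * (M ^ j * (\<sigma>\<^sup>2) ^ (j + r))"
      proof -
        have "2 * j + 2 * r = 2 * (j + r)" by simp
        thus ?thesis by (simp only: gauss_moment_def power_mult) simp
      qed
      also have "M ^ j * (\<sigma>\<^sup>2) ^ (j + r) = (w\<^sup>2 / (w + 1)) ^ (j + r) / M ^ r"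
        using M w unfolding \<sigma>(2) by (simp add: power_divide power_mult_distrib power_add)
      finally show ?thesis by simp
    qed
    have "I (2 * r) = (\<Sum>k=0..2*r. \<Sum>j=0..k. (1 / fact j * ?b k j * f_coeff \<beta> (2 * r - k) w) *
         (M ^ j * gauss_moment \<sigma> (2 * j + 2 * r)))"
      unfolding I_def by (intro sum.cong refl) (simp only: mult_ac divide_inverse mult_1_left)
    also have "\<dots> = (\<Sum>k=0..2*r. \<Sum>j=0..k. (1 / fact j * ?b k j * f_coeff \<beta> (2 * r - k) w) *
         (sqrt (2 * pi) * \<sigma> * odd_dfact (j + r) * (w\<^sup>2 / (w + 1)) ^ (j + r) / M ^ r))"
      unfolding gm ..
    \<comment> \<open>Swapping the triangular sum puts the power of s outside, the order in which
      \<open>A_coeff\<close> is written.\<close>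
    also have "\<dots> = (\<Sum>j=0..2*r. \<Sum>k=j..2*r. (1 / fact j * ?b k j * f_coeff \<beta> (2 * r - k) w) *
         (sqrt (2 * pi) * \<sigma> * odd_dfact (j + r) * (w\<^sup>2 / (w + 1)) ^ (j + r) / M ^ r))"
    proof -
      have "(\<Sum>k=0..n. \<Sum>j=0..k. g k j) = (\<Sum>j=0..n. \<Sum>k=j..n. g k j)" for n :: nat and g :: "nat \<Rightarrow> nat \<Rightarrow> real"
        by (subst (1 2) sum.Sigma)
           (auto intro!: sum.reindex_bij_witness[of _ "\<lambda>(a, b). (b, a)" "\<lambda>(a, b). (b, a)"])
      thus ?thesis .
    qed
    also have "\<dots> = sqrt (2 * pi) * \<sigma> * (A_coeff \<beta> r w / M ^ r)"
      unfolding A_coeff_def sum_divide_distrib sum_distrib_left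
      by (intro sum.cong refl) (simp add: mult_ac)
    finally show ?thesis .
  qed
  have "has_bochner_integral lborel
     (\<lambda>z. \<Sum>i<2*K. exp (- z\<^sup>2 / (2 * \<sigma>\<^sup>2)) * (fps_nth (saddle_fps \<beta> w (M * z\<^sup>2)) i * z ^ i)) (\<Sum>i<2*K. I i)"
    by (intro has_bochner_integral_sum int)
  also have "(\<Sum>i<2*K. I i) = sqrt (2 * pi) * \<sigma> * (\<Sum>r<K. A_coeff \<beta> r w / M ^ r)"
    by (simp only: sum_even_odd odd even sum_distrib_left add_0_right)
  finally show ?thesis by (simp only: sum_distrib_left)
qed

lemma measurable_phase [measurable]: "phase w \<in> borel_measurable borel"
  unfolding phase_def[abs_def] by measurable

lemma measurable_amplitude [measurable]: "amplitude \<beta> w \<in> borel_measurable borel"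
  unfolding amplitude_def[abs_def] by measurable

lemma inner_integral:
  fixes w M \<beta> :: real and K :: nat
  assumes w: "w \<ge> 256" and M: "M > 0"
  defines "\<sigma> \<equiv> w / sqrt (M * (w + 1))"
  defines "f \<equiv> (\<lambda>z. if \<bar>z\<bar> \<le> 1 / (4 * w) then exp (M * phase w z) * amplitude \<beta> w z else 0)"
  shows "integrable lborel f"
    and "\<bar>(\<integral>z. f z \<partial>lborel) - sqrt (2 * pi) * \<sigma> * (\<Sum>r<K. A_coeff \<beta> r w / M ^ r)\<bar> \<le>
      2 * exp (\<bar>\<beta>\<bar> + 1) * real (2 * K + 2) * 32 ^ K * odd_dfact K * (sqrt (2 * pi) * \<sigma> * (w ^ 3 / M) ^ K)"
proof -
  \<comment> \<open>The variance 2w/M belongs to the exponent -M z^2/(4w), which bounds what is left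
    of the Gaussian after it has absorbed exp(64 M z^2/w^2).\<close>
  define \<tau> where "\<tau> = sqrt (2 * w / M)"
  have \<sigma>: "\<sigma> > 0" "\<sigma>\<^sup>2 = w\<^sup>2 / (M * (w + 1))"
    using w M by (auto simp: \<sigma>_def power_divide)
  have \<tau>: "\<tau> > 0" "\<tau>\<^sup>2 = 2 * w / M" using w M by (auto simp: \<tau>_def)
  define g where "g = (\<lambda>z. exp (- z\<^sup>2 / (2 * \<sigma>\<^sup>2)) * (\<Sum>i<2*K. fps_nth (saddle_fps \<beta> w (M * z\<^sup>2)) i * z ^ i))"
  have g: "has_bochner_integral lborel g (sqrt (2 * pi) * \<sigma> * (\<Sum>r<K. A_coeff \<beta> r w / M ^ r))"
    unfolding g_def using w M \<sigma> by (intro has_bochner_integral_gauss_saddle) auto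
  define C where "C = exp (\<bar>\<beta>\<bar> + 1) * real (2 * K + 2) * 16 ^ K"
  have C: "C \<ge> 0" by (simp add: C_def)
  define d where "d = (\<lambda>z::real. (C * w ^ (2 * K)) * (exp (- z\<^sup>2 / (2 * \<tau>\<^sup>2)) * z ^ (2 * K)))"
  have d: "has_bochner_integral lborel d ((C * w ^ (2 * K)) * gauss_moment \<tau> (2 * K))"
    unfolding d_def by (intro has_bochner_integral_mult_right has_bochner_integral_gauss_moment \<tau>)
  have fg: "\<bar>f z - g z\<bar> \<le> d z" for z
  proof -
    define a where "a = (w + 1) / (2 * w\<^sup>2)"
    have sa: "- z\<^sup>2 / (2 * \<sigma>\<^sup>2) = - (M * a * z\<^sup>2)" unfolding \<sigma>(2) a_def using w M by (simp add: field_simps)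
    let ?h = "if \<bar>z\<bar> \<le> 1 / (4 * w) then exp (M * (phase w z + (w + 1) / (2 * w\<^sup>2) * z\<^sup>2)) * amplitude \<beta> w z else 0"
    have "f z = exp (- z\<^sup>2 / (2 * \<sigma>\<^sup>2)) * ?h"
    proof -
      have "exp (M * phase w z) = exp (- (M * a * z\<^sup>2)) * exp (M * (phase w z + a * z\<^sup>2))"
        by (simp add: algebra_simps flip: exp_add)
      thus ?thesis unfolding f_def sa a_def[symmetric] by simp
    qed
    hence "f z - g z = exp (- z\<^sup>2 / (2 * \<sigma>\<^sup>2)) * (?h - (\<Sum>i<2*K. fps_nth (saddle_fps \<beta> w (M * z\<^sup>2)) i * z ^ i))"
      by (simp only: g_def right_diff_distrib)
    also have "\<bar>\<dots>\<bar> = exp (- z\<^sup>2 / (2 * \<sigma>\<^sup>2)) * \<bar>?h - (\<Sum>i<2*K. fps_nth (saddle_fps \<beta> w (M * z\<^sup>2)) i * z ^ i)\<bar>"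
      by (simp only: abs_mult abs_exp_cancel)
    also have "\<dots> \<le> exp (- z\<^sup>2 / (2 * \<sigma>\<^sup>2)) * (C * (exp (64 * (M * z\<^sup>2) / w\<^sup>2) * (w * z) ^ (2 * K)))"
      unfolding C_def using w M by (intro mult_left_mono saddle_taylor_bound) auto
    also have "\<dots> = C * (w * z) ^ (2 * K) * exp (- z\<^sup>2 / (2 * \<sigma>\<^sup>2) + 64 * (M * z\<^sup>2) / w\<^sup>2)"
      by (simp only: exp_add mult_ac)
    also have "\<dots> \<le> C * (w * z) ^ (2 * K) * exp (- z\<^sup>2 / (2 * \<tau>\<^sup>2))"
    proof (intro mult_left_mono)
      \<comment> \<open>Multiplied by w^2 this reads w/4 >= 63.5, so \<open>w \<ge> 256\<close> is
        enough.\<close>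
      have "1 / (4 * w) \<le> a - 64 / w\<^sup>2" using w by (simp add: a_def field_simps power2_eq_square)
      hence "M * z\<^sup>2 * (1 / (4 * w)) \<le> M * z\<^sup>2 * (a - 64 / w\<^sup>2)" using M by (intro mult_left_mono) auto
      moreover have "- z\<^sup>2 / (2 * \<tau>\<^sup>2) = - (M * z\<^sup>2 * (1 / (4 * w)))" unfolding \<tau>(2) using w M by (simp add: field_simps)
      moreover have "- (M * a * z\<^sup>2) + 64 * (M * z\<^sup>2) / w\<^sup>2 = - (M * z\<^sup>2 * (a - 64 / w\<^sup>2))"
        by (simp add: algebra_simps)
      ultimately show "exp (- z\<^sup>2 / (2 * \<sigma>\<^sup>2) + 64 * (M * z\<^sup>2) / w\<^sup>2) \<le> exp (- z\<^sup>2 / (2 * \<tau>\<^sup>2))"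
        unfolding sa by simp
    qed (use C in \<open>auto simp: power_mult\<close>)
    also have "\<dots> = d z" by (simp add: d_def power_mult_distrib mult_ac)
    finally show ?thesis .
  qed
  have meas: "f \<in> borel_measurable lborel" unfolding f_def by measurable
  have g_int: "integrable lborel g" and d_int: "integrable lborel d"
    using g d by (auto simp: has_bochner_integral_iff)
  have fg_int: "integrable lborel (\<lambda>z. f z - g z)"
  proof (rule Bochner_Integration.integrable_bound[OF d_int])
    show "(\<lambda>z. f z - g z) \<in> borel_measurable lborel" using meas g_int by auto
    show "AE z in lborel. norm (f z - g z) \<le> norm (d z)"
    proof (rule AE_I2)
      fix z show "norm (f z - g z) \<le> norm (d z)" using fg[of z] by simp
    qed
  qed
  have "integrable lborel (\<lambda>z. (f z - g z) + g z)" by (rule Bochner_Integration.integrable_add[OF fg_int g_int])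
  thus f_int: "integrable lborel f" by simp
  have "(\<integral>z. f z \<partial>lborel) - sqrt (2 * pi) * \<sigma> * (\<Sum>r<K. A_coeff \<beta> r w / M ^ r) = (\<integral>z. f z - g z \<partial>lborel)"
    using g f_int by (simp add: has_bochner_integral_iff)
  also have "\<bar>\<dots>\<bar> \<le> (\<integral>z. \<bar>f z - g z\<bar> \<partial>lborel)" by (rule integral_abs_bound)
  also have "\<dots> \<le> (\<integral>z. d z \<partial>lborel)"
    using fg_int d_int fg by (intro integral_mono) auto
  also have "\<dots> = (C * w ^ (2 * K)) * gauss_moment \<tau> (2 * K)" using d by (simp add: has_bochner_integral_iff)
  also have "\<dots> = C * w ^ (2 * K) * (sqrt (2 * pi) * \<tau> * (\<tau>\<^sup>2) ^ K * odd_dfact K)"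
    by (simp add: gauss_moment_def power_mult)
  also have "\<dots> = C * odd_dfact K * sqrt (2 * pi) * \<tau> * (2 * (w ^ 3 / M)) ^ K"
  proof -
    have "w ^ (2 * K) * (\<tau>\<^sup>2) ^ K = (w\<^sup>2 * \<tau>\<^sup>2) ^ K" by (simp add: power_mult power_mult_distrib)
    also have "w\<^sup>2 * \<tau>\<^sup>2 = 2 * (w ^ 3 / M)" unfolding \<tau>(2) by (simp add: power2_eq_square power3_eq_cube)
    finally show ?thesis by (simp add: mult_ac)
  qed
  \<comment> \<open>Since w + 1 <= 2w, the wider Gaussian satisfies \<tau> <= 2 \<sigma>, so the
    error can be stated relative to the main width.\<close>
  also have "\<dots> \<le> C * odd_dfact K * sqrt (2 * pi) * (2 * \<sigma>) * (2 * (w ^ 3 / M)) ^ K"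
  proof -
    have "2 * w / M * 1 \<le> 2 * w / M * (2 * w / (w + 1))"
      using w M by (intro mult_left_mono) (auto simp: field_simps)
    moreover have "2 * w / M * (2 * w / (w + 1)) = 4 * (w\<^sup>2 / (M * (w + 1)))"
      unfolding power2_eq_square times_divide_times_eq by simp
    ultimately have "2 * w / M \<le> 4 * (w\<^sup>2 / (M * (w + 1)))" by (simp only: mult_1_right)
    hence "\<tau>\<^sup>2 \<le> (2 * \<sigma>)\<^sup>2" unfolding power_mult_distrib \<tau>(2) \<sigma>(2) by simp
    hence "\<tau> \<le> 2 * \<sigma>" by (rule power2_le_imp_le) (use \<sigma>(1) in simp)
    moreover have "odd_dfact K \<ge> 0" by (simp add: odd_dfact_def prod_nonneg)
    ultimately show ?thesis using C w M by (intro mult_right_mono mult_left_mono) auto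
  qed
  also have "\<dots> = 2 * exp (\<bar>\<beta>\<bar> + 1) * real (2 * K + 2) * 32 ^ K * odd_dfact K * (sqrt (2 * pi) * \<sigma> * (w ^ 3 / M) ^ K)"
  proof -
    have "(32::real) ^ K = 16 ^ K * 2 ^ K" by (simp flip: power_mult_distrib)
    thus ?thesis unfolding C_def power_mult_distrib by (simp only: mult_ac)
  qed
  finally show "\<bar>(\<integral>z. f z \<partial>lborel) - sqrt (2 * pi) * \<sigma> * (\<Sum>r<K. A_coeff \<beta> r w / M ^ r)\<bar> \<le>
      2 * exp (\<bar>\<beta>\<bar> + 1) * real (2 * K + 2) * 32 ^ K * odd_dfact K * (sqrt (2 * pi) * \<sigma> * (w ^ 3 / M) ^ K)" .
qed

section \<open>The saddle point integral\<close>

lemma bigo_cmult_left: "f \<in> O[F](g) \<Longrightarrow> (\<lambda>x. c * f x) \<in> O[F](g)" for c :: real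
  by (cases "c = 0") auto

text \<open>With r = sqrt(1 + z), the inequality ln r <= r - 1 leaves (r - 1)^2, and z = (r - 1)(r +
  1). The bound is quadratic near 0 and linear for large z, so it serves the whole half line at
  once.\<close>

lemma diff_ln_lower_bound:
  fixes z :: real
  assumes "z > -1"
  shows "z\<^sup>2 / (4 * (1 + \<bar>z\<bar>)) \<le> z - ln (1 + z)"
proof -
  define r where "r = sqrt (1 + z)"
  have r: "r > 0" "r\<^sup>2 = 1 + z" using assms by (auto simp: r_def)
  have "ln (1 + z) = 2 * ln r" using r by (simp add: ln_realpow flip: r(2))
  also have "\<dots> \<le> 2 * (r - 1)" using ln_le_minus_one[OF r(1)] by simp
  finally have "(r - 1)\<^sup>2 \<le> z - ln (1 + z)"
    using r(2) by (simp add: power2_eq_square algebra_simps)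
  moreover have "z\<^sup>2 / (4 * (1 + \<bar>z\<bar>)) \<le> (r - 1)\<^sup>2"
  proof -
    have "z = (r - 1) * (r + 1)" using r(2) by (simp add: power2_eq_square algebra_simps)
    hence "z\<^sup>2 = (r - 1)\<^sup>2 * (r + 1)\<^sup>2" by (simp add: power_mult_distrib)
    also have "\<dots> \<le> (r - 1)\<^sup>2 * (4 * (1 + \<bar>z\<bar>))"
    proof (intro mult_left_mono)
      have "(r + 1)\<^sup>2 = 2 * (r\<^sup>2 + 1) - (r - 1)\<^sup>2" by (simp add: power2_eq_square algebra_simps)
      also have "\<dots> \<le> 2 * (r\<^sup>2 + 1)" by simp
      also have "\<dots> \<le> 4 * (1 + \<bar>z\<bar>)" unfolding r(2) by (simp add: abs_if)
      finally show "(r + 1)\<^sup>2 \<le> 4 * (1 + \<bar>z\<bar>)" .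
    qed auto
    finally show ?thesis by (simp add: divide_simps)
  qed
  ultimately show ?thesis by linarith
qed

text \<open>Only the outer logarithm is linearised, by ln(1 + u) <= u. Since M/w = pi e^w, the
  exponent M \<open>phase w z\<close> is then at most -pi e^w (z - ln(1 + z)).\<close>

lemma phase_le:
  assumes "w > 0" "z > exp (-w) - 1"
  shows "phase w z \<le> - (z - ln (1 + z)) / w"
proof -
  have "exp (-w) < 1 + z" using assms by simp
  hence "-w < ln (1 + z)" by (metis exp_gt_zero ln_exp ln_less_cancel_iff order.strict_trans)
  hence "1 + ln (1 + z) / w > 0" using assms by (simp add: field_simps)
  hence "ln (1 + ln (1 + z) / w) \<le> ln (1 + z) / w" using ln_le_minus_one by fastforce
  thus ?thesis using assms by (simp add: phase_def diff_divide_distrib)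
qed

text \<open>Completing the square gives (w^2 - (ln(1 + z) + w)^2)/16 in the exponent. The loss
  exp(w^2/16) is harmless beside a decay exponential in e^w/w^2.\<close>

lemma amplitude_le:
  assumes \<beta>: "0 \<le> \<beta>" "\<beta> \<le> 2" and z: "z > -1"
  shows "0 \<le> amplitude \<beta> w z" "amplitude \<beta> w z \<le> (2 + z)\<^sup>2 * exp (w\<^sup>2 / 16)"
proof -
  show "0 \<le> amplitude \<beta> w z" by (simp add: amplitude_def)
  define L where "L = ln (1 + z)"
  have "- w / 8 * L - L\<^sup>2 / 16 = w\<^sup>2 / 16 - (L + w)\<^sup>2 / 16" by (simp add: power2_eq_square field_simps)
  hence 1: "- w / 8 * L - L\<^sup>2 / 16 \<le> w\<^sup>2 / 16" by simp
  have "(1 + z) powr \<beta> \<le> (2 + z) powr \<beta>" using z \<beta> by (intro powr_mono2) auto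
  also have "\<dots> \<le> (2 + z) powr 2" using z \<beta> by (intro powr_mono) auto
  also have "\<dots> = (2 + z)\<^sup>2" using z by simp
  finally show "amplitude \<beta> w z \<le> (2 + z)\<^sup>2 * exp (w\<^sup>2 / 16)"
    unfolding amplitude_def L_def[symmetric] using 1 by (intro mult_mono) auto
qed

text \<open>The exponent -m k, with m = pi e^w and k = z - ln(1 + z), is halved: one half, with the
  lower bound of k coming from |z| = 1/(4w), gives the small factor; the other, with m/2 >= 1, gives
  integrable decay in z.\<close>

lemma outer_bound:
  assumes w: "w \<ge> 256" and \<beta>: "0 \<le> \<beta>" "\<beta> \<le> 2"
    and z: "z > exp (-w) - 1" "\<bar>z\<bar> > 1 / (4 * w)"
  shows "exp (pi * w * exp w * phase w z) * amplitude \<beta> w z \<le>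
     exp (w\<^sup>2 / 16 - pi * exp w / (256 * w\<^sup>2)) * (216 * exp 1 * exp (- (1/2) * z))"
proof -
  define m where "m = pi * exp w"
  have z1: "z > -1" using z(1) by (smt (verit) exp_gt_zero)
  define k where "k = z - ln (1 + z)"
  have m: "m \<ge> 2"
  proof -
    have "m \<ge> 3 * 1" unfolding m_def using pi_gt3 w by (intro mult_mono) auto
    thus ?thesis by simp
  qed
  define d where "d = 1 / (4 * w)"
  have d: "0 < d" "d \<le> 1" "d \<le> \<bar>z\<bar>" using w z by (auto simp: d_def field_simps)
  have "1 / (128 * w\<^sup>2) = d\<^sup>2 / (4 * 2)" by (simp add: d_def power2_eq_square)
  also have "\<dots> \<le> d\<^sup>2 / (4 * (1 + d))" using d by (intro divide_left_mono) auto
  \<comment> \<open>The function t^2/(1 + t) increases for t >= 0; the cleared difference factors as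
    (|z| - d)(|z| + d + |z| d).\<close>
  also have "\<dots> \<le> z\<^sup>2 / (4 * (1 + \<bar>z\<bar>))"
  proof -
    have "0 \<le> (\<bar>z\<bar> - d) * (\<bar>z\<bar> + d + \<bar>z\<bar> * d)" using d by simp
    hence "d\<^sup>2 * (1 + \<bar>z\<bar>) \<le> \<bar>z\<bar>\<^sup>2 * (1 + d)" by (simp add: algebra_simps power2_eq_square)
    thus ?thesis using d by (simp add: divide_simps) (simp add: algebra_simps)
  qed
  also have "\<dots> \<le> k" unfolding k_def by (rule diff_ln_lower_bound[OF z1])
  finally have k: "1 / (128 * w\<^sup>2) \<le> k" .
  have k0: "k \<ge> 0" by (rule order_trans[OF _ k]) simp
  have "pi * w * exp w * phase w z \<le> pi * w * exp w * (- k / w)"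
    unfolding k_def using phase_le[of w z] w z by (intro mult_left_mono) auto
  also have "\<dots> = - (m / 2 * k) - m / 2 * k" using w by (simp add: m_def)
  also have "\<dots> \<le> - (m / 2 * (1 / (128 * w\<^sup>2))) - 1 * k"
    using k k0 m by (intro diff_mono le_imp_neg_le mult_left_mono mult_right_mono) auto
  also have "\<dots> = - pi * exp w / (256 * w\<^sup>2) + (ln (1 + z) - z)" by (simp add: m_def k_def)
  finally have "exp (pi * w * exp w * phase w z) \<le> exp (- pi * exp w / (256 * w\<^sup>2) + (ln (1 + z) - z))"
    by simp
  also have "\<dots> = exp (- pi * exp w / (256 * w\<^sup>2)) * ((1 + z) * exp (- z))"
    unfolding exp_add exp_diff using z1 by (simp add: exp_minus field_simps)
  also have "\<dots> \<le> exp (- pi * exp w / (256 * w\<^sup>2)) * ((2 + z) * exp (- z))"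
    using z1 by (intro mult_left_mono mult_right_mono) auto
  finally have "exp (pi * w * exp w * phase w z) * amplitude \<beta> w z \<le>
      exp (- pi * exp w / (256 * w\<^sup>2)) * ((2 + z) * exp (- z)) * ((2 + z)\<^sup>2 * exp (w\<^sup>2 / 16))"
    using amplitude_le[OF \<beta> z1, of w] z1 by (intro mult_mono) auto
  also have "\<dots> = exp (w\<^sup>2 / 16 - pi * exp w / (256 * w\<^sup>2)) * ((2 + z) ^ 3 * exp (- z))"
  proof -
    have "exp (w\<^sup>2 / 16 - pi * exp w / (256 * w\<^sup>2)) = exp (w\<^sup>2 / 16) * exp (- pi * exp w / (256 * w\<^sup>2))"
      by (simp flip: exp_add)
    moreover have "(2 + z) ^ 3 = (2 + z) * (2 + z)\<^sup>2" by (simp add: power3_eq_cube power2_eq_square)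
    ultimately show ?thesis by (simp only: mult_ac)
  qed
  also have "\<dots> \<le> exp (w\<^sup>2 / 16 - pi * exp w / (256 * w\<^sup>2)) * (216 * exp 1 * exp (- (1/2) * z))"
  proof (intro mult_left_mono)
    \<comment> \<open>The divisor 6 is chosen so that cubing gives exp(1 + z/2), which uses up half
      of exp(-z); 216 is its cube.\<close>
    have "(2 + z) / 6 \<le> exp ((2 + z) / 6)" using exp_ge_add_one_self[of "(2 + z) / 6"] by linarith
    hence "((2 + z) / 6) ^ 3 \<le> exp ((2 + z) / 6) ^ 3" using z1 by (intro power_mono) auto
    hence "(2 + z) ^ 3 \<le> 216 * exp (1 + z / 2)"
      by (simp add: power_divide flip: exp_of_nat_mult) (simp add: add_divide_distrib)
    hence "(2 + z) ^ 3 * exp (- z) \<le> 216 * exp (1 + z / 2) * exp (- z)" by (intro mult_right_mono) auto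
    also have "\<dots> = 216 * exp 1 * exp (- (1/2) * z)" by (simp add: mult.assoc flip: exp_add)
    finally show "(2 + z) ^ 3 * exp (- z) \<le> 216 * exp 1 * exp (- (1/2) * z)" .
  qed auto
  finally show ?thesis .
qed

lemma set_integrable_exp_minus:
  fixes a c :: real
  assumes "a > 0"
  shows "set_integrable lborel {c..} (\<lambda>x. exp (- a * x))"
proof -
  have "(\<lambda>x. exp (- a * x)) absolutely_integrable_on {c..}"
    using assms by (intro nonnegative_absolutely_integrable_1 integrable_on_exp_minus_to_infinity) auto
  thus ?thesis
    unfolding set_integrable_def
    by (subst (asm) integrable_completion) auto
qed

text \<open>The lower limit exp(-w) - 1 is the image of x = 0 under e^(2x) = e^w (1 + z).\<close>

definition saddle_integral :: "real \<Rightarrow> real \<Rightarrow> real" where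
  "saddle_integral \<beta> w = (LBINT z:{exp (-w) - 1<..}. exp (pi * w * exp w * phase w z) * amplitude \<beta> w z)"

definition saddle_width :: "real \<Rightarrow> real" where
  "saddle_width w = w / sqrt (pi * w * exp w * (w + 1))"

lemma saddle_integral_bound:
  fixes w \<beta> :: real and K :: nat
  assumes w: "w \<ge> 256" and \<beta>: "0 \<le> \<beta>" "\<beta> \<le> 2"
  defines "M \<equiv> pi * w * exp w"
  shows "set_integrable lborel {exp (-w) - 1<..} (\<lambda>z. exp (M * phase w z) * amplitude \<beta> w z)"
    and "\<bar>saddle_integral \<beta> w - sqrt (2 * pi) * saddle_width w * (\<Sum>r<K. A_coeff \<beta> r w / M ^ r)\<bar> \<le>
      2 * exp (\<bar>\<beta>\<bar> + 1) * real (2 * K + 2) * 32 ^ K * odd_dfact K *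
        (sqrt (2 * pi) * saddle_width w * (w ^ 3 / M) ^ K) +
      exp (w\<^sup>2 / 16 - pi * exp w / (256 * w\<^sup>2)) *
        (216 * exp 1 * (LBINT z:{-1..}. exp (- (1/2) * z)))"
proof -
  have M: "M > 0" using w by (simp add: M_def)
  have width: "saddle_width w = w / sqrt (M * (w + 1))" by (simp add: saddle_width_def M_def)
  let ?S = "{exp (-w) - 1<..}" and ?h = "\<lambda>z. exp (M * phase w z) * amplitude \<beta> w z"
  define f1 where "f1 = (\<lambda>z. if \<bar>z\<bar> \<le> 1 / (4 * w) then ?h z else 0)"
  define f2 where "f2 = (\<lambda>z. if \<bar>z\<bar> > 1 / (4 * w) \<and> z \<in> ?S then ?h z else 0)"
  define d where "d = (\<lambda>z. exp (w\<^sup>2 / 16 - pi * exp w / (256 * w\<^sup>2)) * (216 * exp 1) *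
     (indicator {-1..} z *\<^sub>R exp (- (1/2) * z)))"
  note f1 = inner_integral[OF w M, of \<beta>, folded f1_def width]
  have eq: "indicator ?S z *\<^sub>R ?h z = f1 z + f2 z" for z
  proof -
    \<comment> \<open>The short interval around the saddle has to lie inside the domain of
      integration for the split to be exact.\<close>
    have "1 / (4 * w) < 1 - exp (- w)"
    proof -
      have "exp (-w) \<le> exp (-1)" using w by simp
      also have "\<dots> = 1 / exp 1" by (simp add: exp_minus field_simps)
      also have "\<dots> \<le> 1 / 2" using exp_ge_add_one_self[of 1] by (intro divide_left_mono) auto
      finally have "exp (-w) \<le> 1/2" .
      moreover have "1 / (4 * w) < 1/2" using w by (simp add: field_simps)
      ultimately show ?thesis by linarith
    qed
    hence "\<bar>z\<bar> \<le> 1 / (4 * w) \<Longrightarrow> z \<in> ?S" by (simp add: abs_if split: if_splits)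
    thus ?thesis by (auto simp: f1_def f2_def indicator_def)
  qed
  have d_int: "integrable lborel d"
    unfolding d_def using set_integrable_exp_minus[of "1/2" "-1", unfolded set_integrable_def] by simp
  have f2d: "0 \<le> f2 z" "f2 z \<le> d z" for z
  proof -
    show "0 \<le> f2 z" by (simp add: f2_def amplitude_def)
    show "f2 z \<le> d z"
    proof (cases "\<bar>z\<bar> > 1 / (4 * w) \<and> z \<in> ?S")
      case True
      hence "z > -1" by (auto intro: less_trans[rotated])
      thus ?thesis using True outer_bound[OF w \<beta>, of z]
        by (simp add: f2_def d_def M_def mult.assoc)
    qed (auto simp: f2_def d_def)
  qed
  have f2_int: "integrable lborel f2"
  proof (rule Bochner_Integration.integrable_bound[OF d_int])
    show "f2 \<in> borel_measurable lborel" unfolding f2_def by measurable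
    show "AE z in lborel. norm (f2 z) \<le> norm (d z)"
    proof (rule AE_I2)
      fix z show "norm (f2 z) \<le> norm (d z)" using f2d[of z] by simp
    qed
  qed
  show "set_integrable lborel ?S ?h"
    unfolding set_integrable_def eq using f1(1) f2_int by (rule Bochner_Integration.integrable_add)
  have J: "saddle_integral \<beta> w = (\<integral>z. f1 z \<partial>lborel) + (\<integral>z. f2 z \<partial>lborel)"
    unfolding saddle_integral_def M_def[symmetric] set_lebesgue_integral_def eq
    using f1(1) f2_int by (rule Bochner_Integration.integral_add)
  have "0 \<le> (\<integral>z. f2 z \<partial>lborel)" using f2d by (intro Bochner_Integration.integral_nonneg) auto
  moreover have "(\<integral>z. f2 z \<partial>lborel) \<le> (\<integral>z. d z \<partial>lborel)" using f2d f2_int d_int by (intro integral_mono) auto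
  moreover have "(\<integral>z. d z \<partial>lborel) = exp (w\<^sup>2 / 16 - pi * exp w / (256 * w\<^sup>2)) *
        (216 * exp 1 * (LBINT z:{-1..}. exp (- (1/2) * z)))"
    unfolding d_def set_lebesgue_integral_def by (simp only: integral_mult_right_zero mult.assoc)
  ultimately show "\<bar>saddle_integral \<beta> w - sqrt (2 * pi) * saddle_width w * (\<Sum>r<K. A_coeff \<beta> r w / M ^ r)\<bar> \<le>
      2 * exp (\<bar>\<beta>\<bar> + 1) * real (2 * K + 2) * 32 ^ K * odd_dfact K *
        (sqrt (2 * pi) * saddle_width w * (w ^ 3 / M) ^ K) +
      exp (w\<^sup>2 / 16 - pi * exp w / (256 * w\<^sup>2)) *
        (216 * exp 1 * (LBINT z:{-1..}. exp (- (1/2) * z)))"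
    using f1(2)[of K] unfolding J by linarith
qed

text \<open>The right-hand base equals w^2 e^(-w)/pi. The simple function exp(-K w) then serves as
  the intermediate comparison for every doubly exponentially small term.\<close>

lemma exp_minus_power_bigo:
  "(\<lambda>w. exp (- (real K * w))) \<in> O[at_top](\<lambda>w. (w ^ 3 / (pi * w * exp w)) ^ K)"
proof -
  have "(\<lambda>w::real. exp (- w)) \<in> O[at_top](\<lambda>w. w ^ 3 / (pi * w * exp w))"
    by real_asymp
  hence "(\<lambda>w::real. exp (- w) ^ K) \<in> O[at_top](\<lambda>w. (w ^ 3 / (pi * w * exp w)) ^ K)"
    by (rule landau_o.big_power)
  thus ?thesis by (simp flip: exp_of_nat_mult)
qed

lemma saddle_integral_expansion:
  assumes \<beta>: "0 \<le> \<beta>" "\<beta> \<le> 2"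
  shows "(\<lambda>w. saddle_integral \<beta> w / (sqrt (2 * pi) * saddle_width w) -
            (\<Sum>r<K. A_coeff \<beta> r w / (pi * w * exp w) ^ r))
         \<in> O[at_top](\<lambda>w. (w ^ 3 / (pi * w * exp w)) ^ K)"
proof -
  define C where "C = 2 * exp (\<bar>\<beta>\<bar> + 1) * real (2 * K + 2) * 32 ^ K * odd_dfact K"
  define D where "D = 216 * exp 1 * (LBINT z:{-1..}. exp (- (1/2) * (z::real))) / sqrt (2 * pi)"
  define e where "e = (\<lambda>w. exp (w\<^sup>2 / 16 - pi * exp w / (256 * w\<^sup>2)) / saddle_width w)"
  \<comment> \<open>Dividing by \<open>saddle_width\<close> costs only a factor of order e^(w/2),
    against a decay exponential in e^w/w^2.\<close>
  have "e \<in> O[at_top](\<lambda>w. exp (- (real K * w)))"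
    unfolding e_def saddle_width_def by real_asymp
  hence e: "e \<in> O[at_top](\<lambda>w. (w ^ 3 / (pi * w * exp w)) ^ K)"
    using exp_minus_power_bigo by (rule landau_o.big_trans)
  have "(\<lambda>w. saddle_integral \<beta> w / (sqrt (2 * pi) * saddle_width w) -
            (\<Sum>r<K. A_coeff \<beta> r w / (pi * w * exp w) ^ r))
         \<in> O[at_top](\<lambda>w. C * (w ^ 3 / (pi * w * exp w)) ^ K + D * e w)"
  proof (rule landau_o.big_mono, rule eventually_mono[OF eventually_ge_at_top[of 256]])
    fix w :: real assume w: "w \<ge> 256"
    define s where "s = sqrt (2 * pi) * saddle_width w"
    have s: "s > 0" "saddle_width w > 0" using w by (auto simp: s_def saddle_width_def)
    let ?A = "\<Sum>r<K. A_coeff \<beta> r w / (pi * w * exp w) ^ r"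
    have "saddle_integral \<beta> w / s - ?A = (saddle_integral \<beta> w - s * ?A) / s"
      using s by (simp add: diff_divide_distrib)
    also have "norm \<dots> = \<bar>saddle_integral \<beta> w - s * ?A\<bar> / s" using s by simp
    also have "\<dots> \<le> (C * (s * (w ^ 3 / (pi * w * exp w)) ^ K) +
       exp (w\<^sup>2 / 16 - pi * exp w / (256 * w\<^sup>2)) *
        (216 * exp 1 * (LBINT z:{-1..}. exp (- (1/2) * z)))) / s"
      using saddle_integral_bound(2)[OF w \<beta>, of K] s unfolding C_def s_def
      by (intro divide_right_mono) auto
    also have "\<dots> = C * (w ^ 3 / (pi * w * exp w)) ^ K + D * e w"
      using s by (simp add: D_def e_def s_def add_divide_distrib)
    finally show "norm (saddle_integral \<beta> w / (sqrt (2 * pi) * saddle_width w) - ?A) \<le>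
        norm (C * (w ^ 3 / (pi * w * exp w)) ^ K + D * e w)"
      unfolding s_def by simp
  qed
  also have "(\<lambda>w. C * (w ^ 3 / (pi * w * exp w)) ^ K + D * e w) \<in> O[at_top](\<lambda>w. (w ^ 3 / (pi * w * exp w)) ^ K)"
    using e by (intro sum_in_bigo bigo_cmult_left) auto
  finally show ?thesis .
qed

section \<open>The theta series\<close>

text \<open>The derivative of order \<open>j\<close> in t of exp(-pi (k + 1)^2 t); the shifted index
  makes \<open>k = 0\<close> the dominant frequency.\<close>

definition theta_term :: "nat \<Rightarrow> nat \<Rightarrow> real \<Rightarrow> real" where
  "theta_term j k t = (- (pi * (real k + 1)\<^sup>2)) ^ j * exp (- (pi * (real k + 1)\<^sup>2) * t)"

text \<open>For d = c/(j + 1) one has (d y)^j <= exp(j d y) <= exp(c y); using j + 1 in place of j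
  keeps d meaningful at j = 0.\<close>

lemma power_mult_exp_bound:
  fixes y c :: real
  assumes "y \<ge> 0" "c > 0"
  shows "y ^ j * exp (- c * y) \<le> ((real j + 1) / c) ^ j"
proof -
  define d where "d = c / (real j + 1)"
  have d: "d > 0" "real j * d \<le> c" using assms by (auto simp: d_def field_simps)
  have "d * y \<le> exp (d * y)" using exp_ge_add_one_self[of "d * y"] by linarith
  hence "(d * y) ^ j \<le> exp (d * y) ^ j" using assms d by (intro power_mono) auto
  also have "\<dots> = exp ((real j * d) * y)" by (simp add: mult_ac flip: exp_of_nat_mult)
  also have "\<dots> \<le> exp (c * y)" using d assms by (simp add: mult_right_mono)
  finally have "y ^ j * exp (- c * y) \<le> (1 / d) ^ j"
    using d by (simp add: power_mult_distrib exp_minus field_simps)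
  thus ?thesis by (simp add: d_def)
qed

lemma abs_theta_term: "\<bar>theta_term j k t\<bar> = (pi * (real k + 1)\<^sup>2) ^ j * exp (- (pi * (real k + 1)\<^sup>2) * t)"
  by (simp add: theta_term_def abs_mult power_abs)

text \<open>Half of the exponential absorbs the power of y = pi (k + 1)^2; the other half is at most
  exp(-a k/2), because y >= k, and this is geometric.\<close>

lemma summable_abs_theta_term:
  assumes "a > 0"
  shows "summable (\<lambda>k. \<bar>theta_term j k a\<bar>)"
proof (rule summable_comparison_test)
  define C where "C = ((real j + 1) / (a / 2)) ^ j"
  have "norm \<bar>theta_term j k a\<bar> \<le> C * exp (- (a / 2)) ^ k" for k
  proof -
    define y where "y = pi * (real k + 1)\<^sup>2"
    have "real k \<le> 1 * (real k + 1)\<^sup>2" by (simp add: power2_eq_square algebra_simps)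
    also have "\<dots> \<le> y" unfolding y_def using pi_gt3 by (intro mult_right_mono) auto
    finally have y: "real k \<le> y" .
    have "\<bar>theta_term j k a\<bar> = (y ^ j * exp (- (a / 2) * y)) * exp (- (a / 2) * y)"
      unfolding abs_theta_term y_def[symmetric] by (simp add: mult.assoc flip: exp_add)
    also have "\<dots> \<le> C * exp (- (a / 2) * real k)"
    proof (rule mult_mono)
      show "y ^ j * exp (- (a / 2) * y) \<le> C" 
        unfolding C_def using assms y by (intro power_mult_exp_bound) auto
      show "exp (- (a / 2) * y) \<le> exp (- (a / 2) * real k)"
        using y assms by (simp add: mult_left_mono)
    qed (use assms in \<open>auto simp: C_def\<close>)
    finally show ?thesis by (simp add: mult_ac flip: exp_of_nat_mult)
  qed
  thus "\<exists>N. \<forall>k\<ge>N. norm \<bar>theta_term j k a\<bar> \<le> C * exp (- (a / 2)) ^ k" by blast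
  show "summable (\<lambda>k. C * exp (- (a / 2)) ^ k)"
    using assms by (intro summable_mult summable_geometric) auto
qed

lemma summable_theta_term: "a > 0 \<Longrightarrow> summable (\<lambda>k. theta_term j k a)"
  by (rule summable_rabs_cancel[OF summable_abs_theta_term])

definition theta_series :: "nat \<Rightarrow> real \<Rightarrow> real" where
  "theta_series j t = (\<Sum>k. theta_term j k t)"

text \<open>On \<open>{t / 2..}\<close> every differentiated term is largest in absolute value at
  the left end, so the values at t/2 serve as majorants in the Weierstrass test.\<close>

lemma theta_series_deriv:
  assumes "t > 0"
  shows "(theta_series j has_real_derivative theta_series (Suc j) t) (at t)"
  unfolding theta_series_def
proof (rule has_field_derivative_series'(2))
  let ?S = "{t / 2..}"
  show "convex ?S" by (rule convex_real_interval)
  show "(theta_term j k has_real_derivative theta_term (Suc j) k x) (at x within ?S)" for k x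
    unfolding theta_term_def[abs_def] by (auto intro!: derivative_eq_intros)
  show "uniformly_convergent_on ?S (\<lambda>n x. \<Sum>k<n. theta_term (Suc j) k x)"
  proof (rule Weierstrass_m_test'_ev[OF always_eventually])
    show "summable (\<lambda>k. \<bar>theta_term (Suc j) k (t / 2)\<bar>)" using assms by (intro summable_abs_theta_term) auto
    show "\<forall>k. \<forall>x\<in>?S. norm (theta_term (Suc j) k x) \<le> \<bar>theta_term (Suc j) k (t / 2)\<bar>"
      unfolding real_norm_def abs_theta_term by (auto intro!: mult_left_mono)
  qed
  show "t \<in> ?S" "t \<in> interior ?S" using assms by (auto simp: interior_real_atLeast)
  show "summable (\<lambda>k. theta_term j k t)"
    by (rule summable_theta_term[OF assms])
qed

lemma theta_eq:
  assumes "t > 0"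
  shows "theta t = 1 + 2 * theta_series 0 t"
proof -
  let ?f = "\<lambda>k::int. exp (- pi * (of_int k)\<^sup>2 * t)"
  have "((\<lambda>k. theta_term 0 k t) has_sum theta_series 0 t) UNIV"
    using summable_abs_theta_term[OF assms, of 0] summable_theta_term[OF assms, of 0]
    unfolding theta_series_def by (intro norm_summable_imp_has_sum summable_sums) auto
  hence base: "((\<lambda>k. exp (- pi * (real k + 1)\<^sup>2 * t)) has_sum theta_series 0 t) UNIV"
    by (simp add: theta_term_def)
  have pos: "(?f has_sum theta_series 0 t) (range (\<lambda>k::nat. int k + 1))"
    by (subst has_sum_reindex) (use base in \<open>auto simp: inj_on_def o_def\<close>)
  have neg: "(?f has_sum theta_series 0 t) (range (\<lambda>k::nat. - (int k + 1)))"
    by (subst has_sum_reindex)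
       (use base in \<open>auto simp: inj_on_def o_def power2_eq_square algebra_simps\<close>)
  have "(?f has_sum 1) {0}" using has_sum_finite[of "{0::int}" ?f] by simp
  moreover have "(?f has_sum (theta_series 0 t + theta_series 0 t))
      (range (\<lambda>k::nat. int k + 1) \<union> range (\<lambda>k::nat. - (int k + 1)))"
    by (rule has_sum_Un_disjoint[OF pos neg]) auto
  ultimately have "(?f has_sum (1 + (theta_series 0 t + theta_series 0 t)))
      ({0} \<union> (range (\<lambda>k::nat. int k + 1) \<union> range (\<lambda>k::nat. - (int k + 1))))"
    by (rule has_sum_Un_disjoint) auto
  also have "{0} \<union> (range (\<lambda>k::nat. int k + 1) \<union> range (\<lambda>k::nat. - (int k + 1))) = UNIV"
  proof -
    have "i = 0 \<or> i \<in> range (\<lambda>k::nat. int k + 1) \<or> i \<in> range (\<lambda>k::nat. - (int k + 1))" for i :: int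
    proof (cases "i > 0")
      case True
      hence "i = int (nat (i - 1)) + 1" by simp
      thus ?thesis by blast
    next
      case False
      hence "i = 0 \<or> i = - (int (nat (- i - 1)) + 1)" by auto
      thus ?thesis by blast
    qed
    thus ?thesis by blast
  qed
  finally show ?thesis unfolding theta_def by (simp add: infsumI)
qed

lemma eventually_nhds_gt_0: "t > 0 \<Longrightarrow> eventually (\<lambda>x. x > 0) (nhds t)" for t :: real
  using eventually_nhds_in_open[of "{0<..}" t] by simp

lemma deriv_theta:
  assumes "t > 0"
  shows "deriv theta t = 2 * theta_series 1 t"
proof -
  have "eventually (\<lambda>x. theta x = 1 + 2 * theta_series 0 x) (nhds t)"
    using eventually_nhds_gt_0[OF assms] by eventually_elim (rule theta_eq)
  hence "deriv theta t = deriv (\<lambda>x. 1 + 2 * theta_series 0 x) t" by (rule deriv_cong_ev) simp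
  also have "\<dots> = 2 * theta_series 1 t"
    using theta_series_deriv[OF assms, of 0]
    by (intro DERIV_imp_deriv) (auto intro!: derivative_eq_intros)
  finally show ?thesis .
qed

lemma deriv_deriv_theta:
  assumes "t > 0"
  shows "deriv (deriv theta) t = 2 * theta_series 2 t"
proof -
  have "eventually (\<lambda>x. deriv theta x = 2 * theta_series 1 x) (nhds t)"
    using eventually_nhds_gt_0[OF assms] by eventually_elim (rule deriv_theta)
  hence "deriv (deriv theta) t = deriv (\<lambda>x. 2 * theta_series 1 x) t" by (rule deriv_cong_ev) simp
  also have "\<dots> = 2 * theta_series 2 t"
    using theta_series_deriv[OF assms, of 1]
    by (intro DERIV_imp_deriv) (auto intro!: derivative_eq_intros simp: numeral_2_eq_2)
  finally show ?thesis .
qed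

section \<open>The kernel \<open>Phi\<close> and its leading part\<close>

lemma Phi_eq:
  "Phi x = 2 * exp (x / 2) * (3 * exp (2 * x) * theta_series 1 (exp (2 * x)) +
     2 * (exp (2 * x))\<^sup>2 * theta_series 2 (exp (2 * x)))"
  by (simp add: Phi_def omega_def deriv_theta deriv_deriv_theta)

lemma measurable_Phi [measurable]: "Phi \<in> borel_measurable borel"
proof (rule borel_measurable_continuous_onI)
  have "isCont (\<lambda>x. theta_series j (exp (2 * x))) x" for j x
  proof (rule isCont_o2[where g = "theta_series j" and f = "\<lambda>x. exp (2 * x)"])
    show "isCont (theta_series j) (exp (2 * x))"
      by (rule DERIV_isCont[OF theta_series_deriv]) simp
  qed auto
  hence [continuous_intros]: "continuous_on UNIV (\<lambda>x. theta_series j (exp (2 * x)))" for j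
    by (simp add: continuous_at_imp_continuous_on)
  show "continuous_on UNIV Phi"
    unfolding Phi_eq[abs_def] by (intro continuous_intros) auto
qed

text \<open>Every later frequency y is at least 4 pi, so (y - 4 pi)(t - 1) >= 0 for t >= 1. Hence
  the absolute tail at t is at most the one at 1 times exp(-4 pi (t - 1)), and the constant is read
  off at t = 1.\<close>

lemma theta_series_tail:
  "\<exists>C\<ge>0. \<forall>t\<ge>1. \<bar>theta_series j t - (- pi) ^ j * exp (- pi * t)\<bar> \<le> C * exp (- 4 * pi * t)"
proof -
  define b where "b = (\<lambda>k. \<bar>theta_term j (k + 1) 1\<bar> * exp (4 * pi))"
  have b: "summable b"
    unfolding b_def
    by (intro summable_mult2 summable_ignore_initial_segment summable_abs_theta_term) auto
  show ?thesis
  proof (intro exI[of _ "suminf b"] conjI allI impI)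
    show "0 \<le> suminf b" using b by (intro suminf_nonneg) (auto simp: b_def)
    fix t :: real assume t: "t \<ge> 1"
    have "(\<lambda>k. theta_term j k t) sums theta_series j t"
      unfolding theta_series_def using t by (intro summable_sums summable_theta_term) auto
    hence "(\<lambda>k. theta_term j (k + 1) t) sums (theta_series j t - (\<Sum>k<1. theta_term j k t))"
      by (rule sums_split_initial_segment)
    hence "(\<lambda>k. theta_term j (k + 1) t) sums (theta_series j t - (- pi) ^ j * exp (- pi * t))"
      by (simp add: theta_term_def)
    moreover have "(\<lambda>k. b k * exp (- 4 * pi * t)) sums (suminf b * exp (- 4 * pi * t))"
      using b by (intro sums_mult2 summable_sums)
    ultimately have "norm (theta_series j t - (- pi) ^ j * exp (- pi * t)) \<le> suminf b * exp (- 4 * pi * t)"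
    proof (rule norm_sums_le)
      fix k
      define y where "y = pi * (real (k + 1) + 1)\<^sup>2"
      have y: "y \<ge> 4 * pi"
      proof -
        have "2\<^sup>2 \<le> (real (k + 1) + 1)\<^sup>2" by (intro power_mono) auto
        hence "pi * 2\<^sup>2 \<le> y" unfolding y_def by (intro mult_left_mono) auto
        thus ?thesis by simp
      qed
      have "norm (theta_term j (k + 1) t) = y ^ j * exp (- y * t)"
        unfolding real_norm_def abs_theta_term y_def ..
      also have "\<dots> \<le> y ^ j * exp (- y + 4 * pi - 4 * pi * t)"
      proof (intro mult_left_mono)
        have "0 \<le> (y - 4 * pi) * (t - 1)" using y t by simp
        thus "exp (- y * t) \<le> exp (- y + 4 * pi - 4 * pi * t)" by (simp add: algebra_simps)
        show "0 \<le> y ^ j" by (simp add: y_def)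
      qed
      also have "\<dots> = y ^ j * exp (- y * 1) * exp (4 * pi) * exp (- 4 * pi * t)"
        by (simp add: mult.assoc flip: exp_add)
      also have "\<dots> = b k * exp (- 4 * pi * t)"
        unfolding b_def abs_theta_term y_def ..
      finally show "norm (theta_term j (k + 1) t) \<le> b k * exp (- 4 * pi * t)" .
    qed
    thus "\<bar>theta_series j t - (- pi) ^ j * exp (- pi * t)\<bar> \<le> suminf b * exp (- 4 * pi * t)" by simp
  qed
qed

text \<open>The contribution of the summands k = 1 and k = -1 of \<open>theta\<close>. Written as
  2(\<beta> + 1)x, the exponents 9x/2 and 5x/2 correspond to \<beta> = 5/4 and \<beta> =
  1/4.\<close>

definition Phi_main :: "real \<Rightarrow> real" where
  "Phi_main x = 4 * pi\<^sup>2 * (exp (9 / 2 * x) * exp (- pi * exp (2 * x))) -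
     6 * pi * (exp (5 / 2 * x) * exp (- pi * exp (2 * x)))"

lemma Phi_main_approx:
  "\<exists>C\<ge>0. \<forall>x\<ge>0. \<bar>Phi x - Phi_main x\<bar> \<le> C * exp (x / 2) * exp (- 3 * pi * exp (2 * x))"
proof -
  obtain C1 where C1: "C1 \<ge> 0" "\<And>t. t \<ge> 1 \<Longrightarrow> \<bar>theta_series 1 t - (- pi) ^ 1 * exp (- pi * t)\<bar> \<le> C1 * exp (- 4 * pi * t)"
    using theta_series_tail[of 1] by blast
  obtain C2 where C2: "C2 \<ge> 0" "\<And>t. t \<ge> 1 \<Longrightarrow> \<bar>theta_series 2 t - (- pi) ^ 2 * exp (- pi * t)\<bar> \<le> C2 * exp (- 4 * pi * t)"
    using theta_series_tail[of 2] by blast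
  show ?thesis
  proof (intro exI[of _ "2 * (6 * C1 + 4 * C2)"] conjI allI impI)
    show "0 \<le> 2 * (6 * C1 + 4 * C2)" using C1 C2 by simp
    fix x :: real assume x: "x \<ge> 0"
    define t where "t = exp (2 * x)"
    have t: "t \<ge> 1" using x by (simp add: t_def)
    define e where "e = exp (- 4 * pi * t)"
    define u where "u = theta_series 1 t - (- pi) ^ 1 * exp (- pi * t)"
    define v where "v = theta_series 2 t - (- pi) ^ 2 * exp (- pi * t)"
    have u: "\<bar>u\<bar> \<le> C1 * e" and v: "\<bar>v\<bar> \<le> C2 * e" using C1 C2 t by (auto simp: u_def v_def e_def)
    have e9: "exp (9 / 2 * x) = exp (x / 2) * t\<^sup>2" and e5: "exp (5 / 2 * x) = exp (x / 2) * t"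
      by (simp_all add: t_def power2_eq_square flip: exp_add)
    have "Phi_main x = 2 * exp (x / 2) * (3 * t * (- pi * exp (- pi * t)) + 2 * t\<^sup>2 * (pi\<^sup>2 * exp (- pi * t)))"
      unfolding Phi_main_def t_def[symmetric] e9 e5 by (simp add: algebra_simps)
    hence "Phi x - Phi_main x = 2 * exp (x / 2) * (3 * t * u + 2 * t\<^sup>2 * v)"
      unfolding Phi_eq t_def[symmetric] u_def v_def by (simp add: algebra_simps)
    also have "\<bar>\<dots>\<bar> = 2 * exp (x / 2) * \<bar>3 * t * u + 2 * t\<^sup>2 * v\<bar>" by (simp add: abs_mult)
    also have "\<dots> \<le> 2 * exp (x / 2) * ((6 * C1 + 4 * C2) * exp (- 3 * pi * t))"
    proof (intro mult_left_mono)
      have tt: "t \<le> t\<^sup>2" using t by (simp add: power2_eq_square)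
      \<comment> \<open>One of the four factors exp(-pi t) pays for the power of t, which leaves
        exp(-3 pi t).\<close>
      have t2: "t\<^sup>2 * e \<le> 2 * exp (- 3 * pi * t)"
      proof -
        have "t\<^sup>2 \<le> 2 * exp t" using exp_lower_Taylor_quadratic[of t] t by simp
        also have "exp t \<le> exp (pi * t)" using pi_gt3 t by simp
        finally have "t\<^sup>2 * e \<le> 2 * exp (pi * t) * e" by (intro mult_right_mono) (auto simp: e_def)
        also have "\<dots> = 2 * exp (- 3 * pi * t)" by (simp add: e_def mult.assoc flip: exp_add)
        finally show ?thesis .
      qed
      have "\<bar>3 * t * u + 2 * t\<^sup>2 * v\<bar> \<le> 3 * t * \<bar>u\<bar> + 2 * t\<^sup>2 * \<bar>v\<bar>"
        using abs_triangle_ineq[of "3 * t * u" "2 * t\<^sup>2 * v"] t by (simp add: abs_mult)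
      also have "\<dots> \<le> 3 * t\<^sup>2 * (C1 * e) + 2 * t\<^sup>2 * (C2 * e)"
        using tt u v t by (intro add_mono mult_mono) auto
      also have "\<dots> = (3 * C1 + 2 * C2) * (t\<^sup>2 * e)" by (simp add: algebra_simps)
      also have "\<dots> \<le> (3 * C1 + 2 * C2) * (2 * exp (- 3 * pi * t))"
        using t2 C1 C2 by (intro mult_left_mono) auto
      finally show "\<bar>3 * t * u + 2 * t\<^sup>2 * v\<bar> \<le> (6 * C1 + 4 * C2) * exp (- 3 * pi * t)"
        by (simp add: algebra_simps)
    qed auto
    finally show "\<bar>Phi x - Phi_main x\<bar> \<le> 2 * (6 * C1 + 4 * C2) * exp (x / 2) * exp (- 3 * pi * exp (2 * x))"
      unfolding t_def by (simp only: mult_ac)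
  qed
qed

section \<open>The integral for the Turan coefficients\<close>

text \<open>The exponent 2(\<beta> + 1)x produces (1 + z)^(\<beta> + 1), and the Jacobian 1/(2(1 +
  z)) lowers this to the power \<beta> of \<open>amplitude\<close>.\<close>

definition monomial_integrand :: "real \<Rightarrow> nat \<Rightarrow> real \<Rightarrow> real" where
  "monomial_integrand \<beta> n x = x ^ (2 * n) * exp (- x\<^sup>2 / 4) * (exp (2 * (\<beta> + 1) * x) * exp (- pi * exp (2 * x)))"

text \<open>The value of x^(2n) exp(-x^2/4) exp(-pi e^(2x)) at the saddle x = w/2, where pi e^w =
  2n/w.\<close>

definition saddle_scale :: "nat \<Rightarrow> real \<Rightarrow> real" where
  "saddle_scale n w = (w / 2) ^ (2 * n) * exp (- 2 * real n / w) * exp (- w\<^sup>2 / 16)"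

lemma monomial_integrand_subst:
  assumes w: "w > 0" "pi * w * exp w = 2 * real n" and z: "z > exp (-w) - 1"
  shows "1 / (2 * (1 + z)) * monomial_integrand \<beta> n ((w + ln (1 + z)) / 2) =
    1 / 2 * saddle_scale n w * exp ((\<beta> + 1) * w) * (exp (pi * w * exp w * phase w z) * amplitude \<beta> w z)"
proof -
  define L where "L = ln (1 + z)"
  have e: "exp (-w) < 1 + z" using z by simp
  hence z1: "1 + z > 0" using exp_gt_zero order.strict_trans by blast
  have eL: "exp L = 1 + z" using z1 by (simp add: L_def)
  have "exp (-w) < exp L" using e eL by simp
  hence L: "-w < L" by simp
  hence pos: "1 + L / w > 0" using w by (simp add: field_simps)
  have m: "pi * exp w = 2 * real n / w" using w by (simp add: field_simps)
  have "((w + L) / 2) ^ (2 * n) = (w / 2) ^ (2 * n) * (1 + L / w) ^ (2 * n)"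
  proof -
    have "(w + L) / 2 = (w / 2) * (1 + L / w)" using w by (simp add: field_simps)
    thus ?thesis by (simp only: power_mult_distrib)
  qed
  also have "(1 + L / w) ^ (2 * n) = exp (2 * real n * ln (1 + L / w))"
    using pos by (simp add: powr_realpow[symmetric] powr_def)
  finally have 1: "((w + L) / 2) ^ (2 * n) = (w / 2) ^ (2 * n) * exp (2 * real n * ln (1 + L / w))" .
  have 2: "exp (- ((w + L) / 2)\<^sup>2 / 4) = exp (- w\<^sup>2 / 16) * exp (- w / 8 * L - L\<^sup>2 / 16)"
  proof -
    have "- ((w + L) / 2)\<^sup>2 / 4 = - w\<^sup>2 / 16 + (- w / 8 * L - L\<^sup>2 / 16)"
      by (simp add: power2_eq_square field_simps)
    thus ?thesis by (simp only: exp_add)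
  qed
  have 3: "exp (2 * (\<beta> + 1) * ((w + L) / 2)) = exp ((\<beta> + 1) * w) * ((1 + z) powr \<beta> * (1 + z))"
  proof -
    have "(1 + z) powr \<beta> * (1 + z) = exp (\<beta> * L + L)"
      using z1 eL by (simp add: powr_def L_def[symmetric] exp_add mult_ac)
    moreover have "2 * (\<beta> + 1) * ((w + L) / 2) = (\<beta> + 1) * w + (\<beta> * L + L)" by (simp add: field_simps)
    ultimately show ?thesis by (simp only: exp_add)
  qed
  have 4: "exp (- pi * exp (2 * ((w + L) / 2))) = exp (- 2 * real n / w) * exp (2 * real n * (- z / w))"
  proof -
    have "2 * ((w + L) / 2) = w + L" by simp
    hence "exp (2 * ((w + L) / 2)) = exp w * (1 + z)" using eL by (simp only: exp_add)
    hence "pi * exp (2 * ((w + L) / 2)) = (2 * real n / w) * (1 + z)"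
      by (simp only: mult.assoc[symmetric] m)
    hence "- pi * exp (2 * ((w + L) / 2)) = - 2 * real n / w + 2 * real n * (- z / w)"
      by (simp add: algebra_simps add_divide_distrib)
    thus ?thesis by (simp only: exp_add)
  qed
  have 5: "exp (2 * real n * ln (1 + L / w)) * exp (2 * real n * (- z / w)) = exp (2 * real n * phase w z)"
    unfolding phase_def L_def[symmetric] exp_add[symmetric] by (simp only: distrib_left[symmetric]) simp
  have "1 / (2 * (1 + z)) * monomial_integrand \<beta> n ((w + L) / 2) =
     1 / 2 * ((w / 2) ^ (2 * n) * exp (- 2 * real n / w) * exp (- w\<^sup>2 / 16)) * exp ((\<beta> + 1) * w) *
      ((exp (2 * real n * ln (1 + L / w)) * exp (2 * real n * (- z / w))) *
       ((1 + z) powr \<beta> * exp (- w / 8 * L - L\<^sup>2 / 16))) * (1 / (1 + z) * (1 + z))"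
  proof -
    have "1 / (2 * (1 + z)) = 1 / 2 * (1 / (1 + z))" by simp
    thus ?thesis unfolding monomial_integrand_def 1 2 3 4 by (simp only: mult_ac)
  qed
  also have "1 / (1 + z) * (1 + z) = 1" using z1 by simp
  finally show ?thesis
    unfolding 5 saddle_scale_def amplitude_def w(2) L_def[symmetric] by simp
qed

lemma measurable_monomial_integrand [measurable]: "monomial_integrand \<beta> n \<in> borel_measurable borel"
  unfolding monomial_integrand_def[abs_def] by measurable

lemma set_integrable_lborel_iff_absolutely_integrable:
  fixes f :: "real \<Rightarrow> real"
  assumes [measurable]: "f \<in> borel_measurable borel" "S \<in> sets borel"
  shows "set_integrable lborel S f \<longleftrightarrow> f absolutely_integrable_on S"
  unfolding set_integrable_def by (subst integrable_completion) auto

lemma monomial_integral: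
  assumes w: "w \<ge> 256" "pi * w * exp w = 2 * real n" and n: "n > 0" and \<beta>: "0 \<le> \<beta>" "\<beta> \<le> 2"
  shows "set_integrable lborel {0..} (monomial_integrand \<beta> n)"
    and "(LBINT x:{0..}. monomial_integrand \<beta> n x) =
       1 / 2 * saddle_scale n w * exp ((\<beta> + 1) * w) * saddle_integral \<beta> w"
proof -
  let ?S = "{exp (-w) - 1<..}"
  define c where "c = 1 / 2 * saddle_scale n w * exp ((\<beta> + 1) * w)"
  let ?h = "\<lambda>z. exp (pi * w * exp w * phase w z) * amplitude \<beta> w z"
  define g where "g = (\<lambda>z. (w + ln (1 + z)) / 2)"
  have z1: "1 + z > 0" if "z \<in> ?S" for z
    using that by (auto intro: less_trans[of 0 "exp (-w)"])
  have h: "set_integrable lborel ?S ?h" by (rule saddle_integral_bound(1)[OF w(1) \<beta>])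
  hence ch: "set_integrable lborel ?S (\<lambda>z. c * ?h z)" by simp
  have chI: "(LBINT z:?S. c * ?h z) = c * saddle_integral \<beta> w"
    unfolding saddle_integral_def by simp
  have eq: "\<bar>1 / (2 * (1 + z))\<bar> * monomial_integrand \<beta> n (g z) = c * ?h z" if "z \<in> ?S" for z
  proof -
    have "\<bar>1 / (2 * (1 + z))\<bar> = 1 / (2 * (1 + z))" using z1[OF that] by simp
    thus ?thesis using monomial_integrand_subst[of w n z \<beta>] w that by (simp only: c_def g_def) simp
  qed
  have img: "g ` ?S = {0<..}"
  proof (intro equalityI subsetI)
    fix x assume "x \<in> g ` ?S"
    then obtain z where z: "z \<in> ?S" "x = g z" by blast
    have "ln (exp (-w)) < ln (1 + z)" using z z1[OF z(1)] by (subst ln_less_cancel_iff) auto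
    thus "x \<in> {0<..}" using z by (simp add: g_def)
  next
    fix x :: real assume x: "x \<in> {0<..}"
    have "x = g (exp (2 * x - w) - 1)" by (simp add: g_def)
    moreover have "exp (2 * x - w) - 1 \<in> ?S" using x by simp
    ultimately show "x \<in> g ` ?S" by blast
  qed
  \<comment> \<open>The equivalence transports integrability and value together, so integrability in
    x comes from that in z.\<close>
  have "(\<lambda>z. \<bar>1 / (2 * (1 + z))\<bar> * monomial_integrand \<beta> n (g z)) absolutely_integrable_on ?S \<and>
           integral ?S (\<lambda>z. \<bar>1 / (2 * (1 + z))\<bar> * monomial_integrand \<beta> n (g z)) = c * saddle_integral \<beta> w
     \<longleftrightarrow> monomial_integrand \<beta> n absolutely_integrable_on (g ` ?S) \<and>
           integral (g ` ?S) (monomial_integrand \<beta> n) = c * saddle_integral \<beta> w"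
  proof (rule has_absolute_integral_change_of_variables_1')
    show "(g has_real_derivative 1 / (2 * (1 + z))) (at z within ?S)" if "z \<in> ?S" for z
      unfolding g_def using z1[OF that] by (auto intro!: derivative_eq_intros simp: field_simps)
    show "inj_on g ?S"
      using z1 by (intro inj_onI) (auto simp: g_def)
  qed auto
  moreover have "(\<lambda>z. \<bar>1 / (2 * (1 + z))\<bar> * monomial_integrand \<beta> n (g z)) absolutely_integrable_on ?S"
  proof -
    have "(\<lambda>z. c * ?h z) absolutely_integrable_on ?S"
      using ch by (subst set_integrable_lborel_iff_absolutely_integrable[symmetric]) auto
    thus ?thesis by (subst set_integrable_cong[OF refl refl eq])
  qed
  moreover have "integral ?S (\<lambda>z. \<bar>1 / (2 * (1 + z))\<bar> * monomial_integrand \<beta> n (g z)) = c * saddle_integral \<beta> w"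
  proof -
    have "integral ?S (\<lambda>z. \<bar>1 / (2 * (1 + z))\<bar> * monomial_integrand \<beta> n (g z)) = integral ?S (\<lambda>z. c * ?h z)"
      by (intro integral_cong eq)
    also have "\<dots> = c * saddle_integral \<beta> w"
      using set_borel_integral_eq_integral(2)[OF ch] chI by (rule trans[OF sym])
    finally show ?thesis .
  qed
  ultimately have G: "monomial_integrand \<beta> n absolutely_integrable_on {0<..}"
     "integral {0<..} (monomial_integrand \<beta> n) = c * saddle_integral \<beta> w"
    unfolding img by blast+
  \<comment> \<open>The end point 0 can be added because the integrand vanishes there for n >
    0.\<close>
  have ind: "indicator {0..} x *\<^sub>R monomial_integrand \<beta> n x = indicator {0<..} x *\<^sub>R monomial_integrand \<beta> n x" for x
    using n by (cases "x = 0") (auto simp: indicator_def monomial_integrand_def)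
  have I: "set_integrable lborel {0<..} (monomial_integrand \<beta> n)"
    using G(1) by (subst set_integrable_lborel_iff_absolutely_integrable) auto
  thus "set_integrable lborel {0..} (monomial_integrand \<beta> n)"
    unfolding set_integrable_def ind .
  have "(LBINT x:{0..}. monomial_integrand \<beta> n x) = (LBINT x:{0<..}. monomial_integrand \<beta> n x)"
    unfolding set_lebesgue_integral_def ind ..
  also have "\<dots> = c * saddle_integral \<beta> w"
    using set_borel_integral_eq_integral(2)[OF I] G(2) by simp
  finally show "(LBINT x:{0..}. monomial_integrand \<beta> n x) =
       1 / 2 * saddle_scale n w * exp ((\<beta> + 1) * w) * saddle_integral \<beta> w"
    by (simp add: c_def)
qed

text \<open>Two tangent lines suffice: x <= (w/2) exp(2x/w - 1), and e^u >= 1 + u at u = 2x + ln 2 -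
  w. With m = pi e^w the terms 2 m x cancel and -m (1 + ln 2) remains. The surplus exp(-m ln 2) over
  the saddle value is what makes the later theta summands negligible.\<close>

lemma power_exp_peak_bound:
  assumes w: "w > 0" "pi * w * exp w = 2 * real n" and x: "x \<ge> 0"
  shows "x ^ (2 * n) * exp (- 2 * pi * exp (2 * x)) \<le>
    (w / 2) ^ (2 * n) * exp (- 2 * real n / w) * exp (- ln 2 * pi * exp w)"
proof -
  define m where "m = pi * exp w"
  have m: "2 * real n = m * w" using w by (simp add: m_def mult_ac)
  have "2 * x / w \<le> exp (2 * x / w - 1)" using exp_ge_add_one_self[of "2 * x / w - 1"] by simp
  hence "x \<le> w / 2 * exp (2 * x / w - 1)" using w by (simp add: field_simps)
  hence "x ^ (2 * n) \<le> (w / 2 * exp (2 * x / w - 1)) ^ (2 * n)" using x by (intro power_mono) auto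
  also have "\<dots> = (w / 2) ^ (2 * n) * exp (2 * real n * (2 * x / w - 1))"
    unfolding power_mult_distrib by (simp flip: exp_of_nat_mult)
  also have "2 * real n * (2 * x / w - 1) = m * (2 * x) - 2 * real n"
    unfolding m using w by (simp add: field_simps)
  finally have 1: "x ^ (2 * n) \<le> (w / 2) ^ (2 * n) * exp (m * (2 * x) - 2 * real n)" .
  have "1 + (2 * x + ln 2 - w) \<le> exp (2 * x + ln 2 - w)" by (rule exp_ge_add_one_self)
  also have "\<dots> = 2 * exp (2 * x) / exp w" by (simp add: exp_diff exp_add)
  finally have "m * (1 + (2 * x + ln 2 - w)) \<le> m * (2 * exp (2 * x) / exp w)"
    by (intro mult_left_mono) (auto simp: m_def)
  also have "\<dots> = 2 * pi * exp (2 * x)" by (simp add: m_def)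
  finally have 2: "- 2 * pi * exp (2 * x) \<le> - m * (1 + (2 * x + ln 2 - w))" by simp
  have "x ^ (2 * n) * exp (- 2 * pi * exp (2 * x)) \<le>
      (w / 2) ^ (2 * n) * exp (m * (2 * x) - 2 * real n) * exp (- m * (1 + (2 * x + ln 2 - w)))"
    using 1 2 x w by (intro mult_mono) auto
  also have "\<dots> = (w / 2) ^ (2 * n) * exp (m * (2 * x) - 2 * real n + - m * (1 + (2 * x + ln 2 - w)))"
    by (simp only: exp_add mult.assoc)
  also have "m * (2 * x) - 2 * real n + - m * (1 + (2 * x + ln 2 - w)) = - 2 * real n / w + - ln 2 * pi * exp w"
  proof -
    have "2 * real n / w = m" using m w by simp
    moreover have "ln 2 * pi * exp w = ln 2 * m" by (simp add: m_def)
    ultimately show ?thesis using m by (simp add: algebra_simps)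
  qed
  finally show ?thesis by (simp only: exp_add mult.assoc)
qed

definition saddle_combination :: "real \<Rightarrow> real" where
  "saddle_combination w = 2 * pi\<^sup>2 * exp (9 / 4 * w) * saddle_integral (5 / 4) w -
     3 * pi * exp (5 / 4 * w) * saddle_integral (1 / 4) w"

text \<open>The constant is uniform in \<open>w\<close> and \<open>n\<close>. In the error,
  exp(-x^2/4) is replaced by 1, and extracting the factor exp(-w^2/16) of
  \<open>saddle_scale\<close> produces the compensating exp(w^2/16).\<close>

lemma turan_integral_approx:
  "\<exists>C\<ge>0. \<forall>w n. w \<ge> 256 \<longrightarrow> n > 0 \<longrightarrow> pi * w * exp w = 2 * real n \<longrightarrow>
     \<bar>(LBINT x:{0..}. x ^ (2 * n) * exp (- x\<^sup>2 / 4) * Phi x) - saddle_scale n w * saddle_combination w\<bar> \<le>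
       saddle_scale n w * (C * exp (w\<^sup>2 / 16 - ln 2 * pi * exp w))"
proof -
  obtain C where C: "C \<ge> 0" "\<And>x. x \<ge> 0 \<Longrightarrow> \<bar>Phi x - Phi_main x\<bar> \<le> C * exp (x / 2) * exp (- 3 * pi * exp (2 * x))"
    using Phi_main_approx by blast
  define D where "D = (LBINT x:{0..}. exp (- 1 * (x::real)))"
  have D: "D \<ge> 0" unfolding D_def set_lebesgue_integral_def by (intro Bochner_Integration.integral_nonneg) auto
  show ?thesis
  proof (intro exI[of _ "C * D"] conjI allI impI)
    show "0 \<le> C * D" using C D by simp
    fix w :: real and n :: nat
    assume w: "w \<ge> 256" "pi * w * exp w = 2 * real n" and n: "n > 0"
    let ?f = "\<lambda>x. x ^ (2 * n) * exp (- x\<^sup>2 / 4) * Phi x"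
    let ?g = "\<lambda>x. x ^ (2 * n) * exp (- x\<^sup>2 / 4) * Phi_main x"
    have g_eq: "?g x = 4 * pi\<^sup>2 * monomial_integrand (5 / 4) n x - 6 * pi * monomial_integrand (1 / 4) n x" for x
      unfolding Phi_main_def monomial_integrand_def by (simp add: algebra_simps)
    have G5: "set_integrable lborel {0..} (monomial_integrand (5 / 4) n)"
      "(LBINT x:{0..}. monomial_integrand (5 / 4) n x) = 1 / 2 * saddle_scale n w * exp ((5 / 4 + 1) * w) * saddle_integral (5 / 4) w"
      using monomial_integral[OF w n, of "5 / 4"] by simp_all
    have G1: "set_integrable lborel {0..} (monomial_integrand (1 / 4) n)"
      "(LBINT x:{0..}. monomial_integrand (1 / 4) n x) = 1 / 2 * saddle_scale n w * exp ((1 / 4 + 1) * w) * saddle_integral (1 / 4) w"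
      using monomial_integral[OF w n, of "1 / 4"] by simp_all
    have g_int: "set_integrable lborel {0..} ?g"
      unfolding g_eq using G5(1) G1(1) by (intro set_integral_diff) auto
    have gI: "(LBINT x:{0..}. ?g x) = saddle_scale n w * saddle_combination w"
    proof -
      have "(LBINT x:{0..}. ?g x) = 4 * pi\<^sup>2 * (LBINT x:{0..}. monomial_integrand (5 / 4) n x) -
          6 * pi * (LBINT x:{0..}. monomial_integrand (1 / 4) n x)"
        unfolding g_eq using G5(1) G1(1) by (subst set_integral_diff) auto
      thus ?thesis unfolding G5(2) G1(2) saddle_combination_def by (simp add: algebra_simps)
    qed
    define c where "c = C * ((w / 2) ^ (2 * n) * exp (- 2 * real n / w) * exp (- ln 2 * pi * exp w))"
    have bound: "\<bar>?f x - ?g x\<bar> \<le> c * exp (- 1 * x)" if x: "x \<ge> 0" for x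
    proof -
      have "\<bar>?f x - ?g x\<bar> = x ^ (2 * n) * exp (- x\<^sup>2 / 4) * \<bar>Phi x - Phi_main x\<bar>"
        using x by (simp add: abs_mult flip: right_diff_distrib)
      also have "\<dots> \<le> x ^ (2 * n) * 1 * (C * exp (x / 2) * exp (- 3 * pi * exp (2 * x)))"
        using C x by (intro mult_mono) auto
      also have "\<dots> = C * (x ^ (2 * n) * exp (- 2 * pi * exp (2 * x))) * exp (x / 2 - pi * exp (2 * x))"
      proof -
        have "exp (x / 2) * exp (- 3 * pi * exp (2 * x)) = exp (- 2 * pi * exp (2 * x)) * exp (x / 2 - pi * exp (2 * x))"
          by (simp flip: exp_add)
        thus ?thesis by simp
      qed
      also have "\<dots> \<le> c * exp (- 1 * x)"
      proof (rule mult_mono)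
        show "C * (x ^ (2 * n) * exp (- 2 * pi * exp (2 * x))) \<le> c"
          unfolding c_def using C x w by (intro mult_left_mono power_exp_peak_bound) auto
        \<comment> \<open>Of exp(-3 pi e^(2x)), two units go into the peak bound; the third supplies
          an integrable majorant that does not depend on n.\<close>
        have "1 * (2 * x) \<le> pi * (1 + 2 * x)" using pi_gt3 x by (intro mult_mono) auto
        also have "\<dots> \<le> pi * exp (2 * x)" using exp_ge_add_one_self[of "2 * x"] by (intro mult_left_mono) auto
        finally show "exp (x / 2 - pi * exp (2 * x)) \<le> exp (- 1 * x)" using x by simp
      qed (use C x w in \<open>auto simp: c_def\<close>)
      finally show ?thesis .
    qed
    have e_int: "set_integrable lborel {0..} (\<lambda>x. c * exp (- 1 * (x::real)))"
      using set_integrable_exp_minus[of 1 0] by simp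
    have d_int: "set_integrable lborel {0..} (\<lambda>x. ?f x - ?g x)"
    proof (rule set_integrable_bound[OF e_int])
      show "set_borel_measurable lborel {0..} (\<lambda>x. ?f x - ?g x)"
        unfolding set_borel_measurable_def Phi_main_def by measurable
      show "AE x in lborel. x \<in> {0..} \<longrightarrow> norm (?f x - ?g x) \<le> norm (c * exp (- 1 * x))"
      proof (intro AE_I2 impI)
        fix x :: real assume "x \<in> {0..}"
        thus "norm (?f x - ?g x) \<le> norm (c * exp (- 1 * x))" using bound[of x] by simp
      qed
    qed
    have f_int: "set_integrable lborel {0..} ?f"
      using set_integral_add(1)[OF d_int g_int] by simp
    have "(LBINT x:{0..}. ?f x) - saddle_scale n w * saddle_combination w = (LBINT x:{0..}. ?f x - ?g x)"
      using set_integral_diff(2)[OF f_int g_int] gI by simp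
    also have "\<bar>\<dots>\<bar> \<le> (LBINT x:{0..}. c * exp (- 1 * x))"
    proof -
      have "norm (LBINT x:{0..}. ?f x - ?g x) \<le> (LBINT x:{0..}. norm (?f x - ?g x))"
        by (rule set_integral_norm_bound[OF d_int])
      also have "\<dots> \<le> (LBINT x:{0..}. c * exp (- 1 * x))"
        using bound by (intro set_integral_mono set_integrable_norm d_int e_int) auto
      finally show ?thesis by simp
    qed
    also have "\<dots> = c * D" unfolding D_def by simp
    also have "\<dots> = saddle_scale n w * (C * D * exp (w\<^sup>2 / 16 - ln 2 * pi * exp w))"
    proof -
      have "exp (- ln 2 * pi * exp w) = exp (- w\<^sup>2 / 16) * exp (w\<^sup>2 / 16 - ln 2 * pi * exp w)"
        by (simp flip: exp_add)
      thus ?thesis unfolding c_def saddle_scale_def by (simp only: mult_ac)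
    qed
    finally show "\<bar>(LBINT x:{0..}. ?f x) - saddle_scale n w * saddle_combination w\<bar> \<le>
       saddle_scale n w * (C * D * exp (w\<^sup>2 / 16 - ln 2 * pi * exp w))" .
  qed
qed

section \<open>Normalisation by the leading factor\<close>

definition turan_leading :: "nat \<Rightarrow> real \<Rightarrow> real" where
  "turan_leading n w = 4 * pi\<^sup>2 * (exp (7 * w / 4 - w\<^sup>2 / 16) / fact (2 * n)) *
     sqrt (2 * w / (w + 1)) * (w / (4 * exp (1 / w))) ^ (2 * n)"

text \<open>The identity sqrt(2 pi) \<open>saddle_width w\<close> = sqrt(2w/(w + 1)) e^(-w/2) lowers
  9w/4 to 7w/4. The power 2^(2n - 1) turns (w/2)^(2n) into (w/4)^(2n) and 2 pi^2 into 4
  pi^2.\<close>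

lemma turan_leading_eq:
  assumes "w > 0"
  shows "turan_leading n w = 1 / (2 powi (2 * int n - 1) * fact (2 * n)) *
    (saddle_scale n w * (2 * pi\<^sup>2 * exp (9 / 4 * w) * (sqrt (2 * pi) * saddle_width w)))"
proof -
  have p: "(2::real) powi (2 * int n - 1) = 2 ^ (2 * n) / 2"
    by (simp add: power_int_diff power_int_mult power_mult)
  have s: "sqrt (2 * pi) * saddle_width w = sqrt (2 * w / (w + 1)) * exp (- w / 2)"
  proof -
    have "saddle_width w = sqrt (w\<^sup>2 / (pi * w * exp w * (w + 1)))"
      using assms by (simp add: saddle_width_def real_sqrt_divide)
    hence "sqrt (2 * pi) * saddle_width w = sqrt (2 * pi * (w\<^sup>2 / (pi * w * exp w * (w + 1))))"
      by (simp only: real_sqrt_mult)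
    also have "2 * pi * (w\<^sup>2 / (pi * w * exp w * (w + 1))) = (2 * w / (w + 1)) * (exp (- w / 2))\<^sup>2"
    proof -
      have "(exp (- w / 2))\<^sup>2 = 1 / exp w" by (simp add: exp_minus field_simps flip: exp_of_nat_mult)
      thus ?thesis using assms by (simp add: power2_eq_square)
    qed
    also have "sqrt \<dots> = sqrt (2 * w / (w + 1)) * exp (- w / 2)" by (simp only: real_sqrt_mult real_sqrt_abs abs_exp_cancel)
    finally show ?thesis .
  qed
  have e: "exp (7 * w / 4 - w\<^sup>2 / 16) = exp (- w\<^sup>2 / 16) * (exp (9 / 4 * w) * exp (- w / 2))"
    by (simp flip: exp_add)
  have q: "(w / (4 * exp (1 / w))) ^ (2 * n) = (w / 2) ^ (2 * n) * exp (- 2 * real n / w) / 2 ^ (2 * n)"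
  proof -
    have "w / (4 * exp (1 / w)) = (w / 2) * exp (- 1 / w) / 2" by (simp add: exp_minus field_simps)
    moreover have "exp (- 1 / w) ^ (2 * n) = exp (- 2 * real n / w)" by (simp flip: exp_of_nat_mult)
    ultimately show ?thesis by (simp only: power_divide power_mult_distrib)
  qed
  show ?thesis
    unfolding turan_leading_def e q p s saddle_scale_def by (simp add: mult_ac)
qed

section \<open>Asymptotic expansion\<close>

definition combination_scale :: "real \<Rightarrow> real" where
  "combination_scale w = 2 * pi\<^sup>2 * exp (9 / 4 * w) * (sqrt (2 * pi) * saddle_width w)"

lemma combination_scale_pos: "w > 0 \<Longrightarrow> combination_scale w > 0"
  by (simp add: combination_scale_def saddle_width_def)

lemma saddle_scale_pos: "w > 0 \<Longrightarrow> saddle_scale n w > 0"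
  by (simp add: saddle_scale_def)

lemma turan_leading_pos: "w > 0 \<Longrightarrow> turan_leading n w > 0"
  by (simp add: turan_leading_def)

lemma turan_ratio_approx:
  "\<exists>C\<ge>0. \<forall>w n. w \<ge> 256 \<longrightarrow> n > 0 \<longrightarrow> pi * w * exp w = 2 * real n \<longrightarrow>
     \<bar>turan_b n / turan_leading n w - saddle_combination w / combination_scale w\<bar> \<le>
       C * exp (w\<^sup>2 / 16 - ln 2 * pi * exp w) / combination_scale w"
proof -
  obtain C where C: "C \<ge> 0" "\<And>w n. w \<ge> 256 \<Longrightarrow> n > 0 \<Longrightarrow> pi * w * exp w = 2 * real n \<Longrightarrow>
     \<bar>(LBINT x:{0..}. x ^ (2 * n) * exp (- x\<^sup>2 / 4) * Phi x) - saddle_scale n w * saddle_combination w\<bar> \<le>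
       saddle_scale n w * (C * exp (w\<^sup>2 / 16 - ln 2 * pi * exp w))"
    using turan_integral_approx by blast
  show ?thesis
  proof (intro exI[of _ C] conjI allI impI)
    fix w :: real and n :: nat
    assume w: "w \<ge> 256" and n: "n > 0" and eq: "pi * w * exp w = 2 * real n"
    define I where "I = (LBINT x:{0..}. x ^ (2 * n) * exp (- x\<^sup>2 / 4) * Phi x)"
    define s where "s = saddle_scale n w"
    define N where "N = combination_scale w"
    define a where "a = 1 / (2 powi (2 * int n - 1) * fact (2 * n) :: real)"
    have s: "s > 0" and N: "N > 0" using w by (auto simp: s_def N_def saddle_scale_pos combination_scale_pos)
    have a: "a > 0" by (simp add: a_def)
    have "turan_b n / turan_leading n w = (a * I) / (a * (s * N))"
      using w turan_leading_eq[of w n] by (simp only: turan_b_def a_def I_def s_def N_def combination_scale_def)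
    also have "\<dots> = I / (s * N)" using a by simp
    finally have "turan_b n / turan_leading n w - saddle_combination w / N = (I - s * saddle_combination w) / (s * N)"
      using s N by (simp add: field_simps)
    also have "\<bar>\<dots>\<bar> = \<bar>I - s * saddle_combination w\<bar> / (s * N)" using s N by simp
    also have "\<dots> \<le> s * (C * exp (w\<^sup>2 / 16 - ln 2 * pi * exp w)) / (s * N)"
      using C(2)[OF w n eq] s N unfolding I_def s_def by (intro divide_right_mono) auto
    also have "\<dots> = C * exp (w\<^sup>2 / 16 - ln 2 * pi * exp w) / N" using s by simp
    finally show "\<bar>turan_b n / turan_leading n w - saddle_combination w / combination_scale w\<bar> \<le>
       C * exp (w\<^sup>2 / 16 - ln 2 * pi * exp w) / combination_scale w" unfolding N_def .
  qed (use C in auto)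
qed

text \<open>The second integral carries the factor 3 e^(-w)/(2 pi) = (3w/2)/M, hence one power of
  1/M, so \<open>K\<close> terms of its expansion match \<open>Suc K\<close> terms of the first.
  This is the shift to \<open>r - 1\<close> in \<open>tau\<close>; the factor 2^r reflects that
  \<open>tau\<close> is normalised for powers of n = M/2.\<close>

lemma saddle_combination_expansion:
  "(\<lambda>w. saddle_combination w / combination_scale w -
       (\<Sum>r<Suc K. tau r w * 2 ^ r / (pi * w * exp w) ^ r))
     \<in> O[at_top](\<lambda>w. (w ^ 3 / (pi * w * exp w)) ^ Suc K)"
proof -
  define M where "M w = pi * w * exp w" for w :: real
  define R where "R = (\<lambda>\<beta> K w. saddle_integral \<beta> w / (sqrt (2 * pi) * saddle_width w) -
            (\<Sum>r<K. A_coeff \<beta> r w / M w ^ r))"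
  have R: "R \<beta> K \<in> O[at_top](\<lambda>w. (w ^ 3 / M w) ^ K)" if "0 \<le> \<beta>" "\<beta> \<le> 2" for \<beta> K
    unfolding R_def M_def using that by (rule saddle_integral_expansion)
  have "(\<lambda>w. exp (- w)) \<in> O[at_top](\<lambda>w. w ^ 3 / M w)"
    unfolding M_def by real_asymp
  hence "(\<lambda>w. exp (- w) * R (1/4) K w) \<in> O[at_top](\<lambda>w. w ^ 3 / M w * (w ^ 3 / M w) ^ K)"
    by (intro landau_o.big.mult R) auto
  hence "(\<lambda>w. 3 / (2 * pi) * (exp (- w) * R (1/4) K w)) \<in> O[at_top](\<lambda>w. (w ^ 3 / M w) ^ Suc K)"
    by (intro bigo_cmult_left) simp
  hence "(\<lambda>w. R (5/4) (Suc K) w - 3 / (2 * pi) * (exp (- w) * R (1/4) K w)) \<in> O[at_top](\<lambda>w. (w ^ 3 / M w) ^ Suc K)"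
    using R[of "5/4" "Suc K"] by (intro sum_in_bigo) auto
  also have "?this \<longleftrightarrow> ?thesis"
  proof (unfold M_def[symmetric], rule landau_o.big.in_cong, rule eventually_mono[OF eventually_gt_at_top[of 0]])
    fix w :: real assume w: "w > 0"
    have Mw: "M w > 0" using w by (simp add: M_def)
    have e: "3 / (2 * pi) * exp (- w) = 3 * w / 2 / M w"
      using w by (simp add: M_def exp_minus field_simps)
    define s where "s = sqrt (2 * pi) * saddle_width w"
    have s: "s > 0" using w by (simp add: s_def saddle_width_def)
    have 1: "saddle_combination w / combination_scale w =
        saddle_integral (5/4) w / s - 3 / (2 * pi) * exp (- w) * (saddle_integral (1/4) w / s)"
    proof -
      have "exp (5 / 4 * w) = exp (9 / 4 * w) * exp (- w)" by (simp flip: exp_add)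
      hence "saddle_combination w = 2 * pi\<^sup>2 * exp (9 / 4 * w) *
          (saddle_integral (5/4) w - 3 / (2 * pi) * exp (- w) * saddle_integral (1/4) w)"
        unfolding saddle_combination_def by (simp add: field_simps power2_eq_square)
      thus ?thesis using s unfolding combination_scale_def s_def[symmetric]
        by (simp add: diff_divide_distrib)
    qed
    have 2: "(\<Sum>r<Suc K. tau r w * 2 ^ r / M w ^ r) =
        (\<Sum>r<Suc K. A_coeff (5/4) r w / M w ^ r) - 3 / (2 * pi) * exp (- w) * (\<Sum>r<K. A_coeff (1/4) r w / M w ^ r)"
    proof -
      have t: "tau r w * 2 ^ r = A_coeff (5/4) r w - 3 * w / 2 * (if r = 0 then 0 else A_coeff (1/4) (r - 1) w)" for r
        by (simp add: tau_def field_simps)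
      have "(\<Sum>r<Suc K. tau r w * 2 ^ r / M w ^ r) = (\<Sum>r<Suc K. A_coeff (5/4) r w / M w ^ r) -
          (\<Sum>r<Suc K. 3 * w / 2 * (if r = 0 then 0 else A_coeff (1/4) (r - 1) w) / M w ^ r)"
        unfolding t diff_divide_distrib sum_subtractf ..
      also have "(\<Sum>r<Suc K. 3 * w / 2 * (if r = 0 then 0 else A_coeff (1/4) (r - 1) w) / M w ^ r) =
          (\<Sum>r<K. 3 * w / 2 * A_coeff (1/4) r w / M w ^ Suc r)"
        by (subst sum.lessThan_Suc_shift) simp
      also have "\<dots> = 3 / (2 * pi) * exp (- w) * (\<Sum>r<K. A_coeff (1/4) r w / M w ^ r)"
        unfolding e sum_distrib_left by (intro sum.cong) (simp_all add: mult_ac)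
      finally show ?thesis .
    qed
    show "R (5/4) (Suc K) w - 3 / (2 * pi) * (exp (- w) * R (1/4) K w) =
       saddle_combination w / combination_scale w - (\<Sum>r<Suc K. tau r w * 2 ^ r / M w ^ r)"
      unfolding 1 2 R_def s_def[symmetric] by (simp only: algebra_simps)
  qed
  finally show ?thesis .
qed

section \<open>The Lambert function at 2n/pi\<close>

lemma lambert_W_exists:
  fixes x :: real assumes "x > 0"
  shows "\<exists>v>0. v * exp v = x"
proof -
  have "\<exists>v\<ge>0. v \<le> x \<and> v * exp v = x"
  proof (rule IVT')
    show "x \<le> x * exp x" using assms by simp
  qed (use assms in \<open>auto intro!: continuous_intros\<close>)
  then obtain v where "v \<ge> 0" "v * exp v = x" by blast
  moreover from this have "v \<noteq> 0" using assms by auto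
  ultimately show ?thesis by (intro exI[of _ v]) auto
qed

lemma lambert_W_pos:
  assumes "x > 0"
  shows "lambert_W x > 0 \<and> lambert_W x * exp (lambert_W x) = x"
proof -
  obtain v where v: "v > 0" "v * exp v = x" using lambert_W_exists[OF assms] by blast
  have "lambert_W x = v"
    unfolding lambert_W_def
  proof (rule the_equality)
    fix u assume u: "- 1 \<le> u \<and> u * exp u = x"
    \<comment> \<open>The defining range starts at -1, but x > 0 excludes u <= 0 and leaves the half
      line on which u exp u is strictly increasing.\<close>
    hence u0: "u > 0" using assms zero_less_mult_pos2[of u "exp u"] by auto
    show "u = v"
    proof (rule linorder_cases[of u v])
      assume "u < v"
      hence "u * exp u < v * exp v" using u0 v by (intro mult_strict_mono) auto
      thus ?thesis using u v by simp
    next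
      assume "v < u"
      hence "v * exp v < u * exp u" using u0 v by (intro mult_strict_mono) auto
      thus ?thesis using u v by simp
    qed
  qed (use v in auto)
  thus ?thesis using v by simp
qed

lemma lambert_W_scaled:
  assumes "n > 0"
  shows "lambert_W (2 * real n / pi) > 0"
    "pi * lambert_W (2 * real n / pi) * exp (lambert_W (2 * real n / pi)) = 2 * real n"
proof -
  have "2 * real n / pi > 0" using assms by simp
  from lambert_W_pos[OF this] show "lambert_W (2 * real n / pi) > 0"
    "pi * lambert_W (2 * real n / pi) * exp (lambert_W (2 * real n / pi)) = 2 * real n"
    by (auto simp: field_simps)
qed

lemma filterlim_lambert_W_scaled: "filterlim (\<lambda>n. lambert_W (2 * real n / pi)) at_top sequentially"
  unfolding filterlim_at_top
proof
  fix B :: real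
  have "filterlim (\<lambda>n. 2 * real n) at_top sequentially" by real_asymp
  hence "eventually (\<lambda>n. 2 * real n > pi * \<bar>B\<bar> * exp \<bar>B\<bar>) sequentially"
    by (simp add: filterlim_at_top_dense)
  thus "eventually (\<lambda>n. B \<le> lambert_W (2 * real n / pi)) sequentially"
    using eventually_gt_at_top[of 0]
  proof eventually_elim
    case (elim n)
    let ?w = "lambert_W (2 * real n / pi)"
    show ?case
    proof (rule ccontr)
      assume "\<not> B \<le> ?w"
      hence "?w \<le> \<bar>B\<bar>" by linarith
      hence "pi * ?w * exp ?w \<le> pi * \<bar>B\<bar> * exp \<bar>B\<bar>"
        using lambert_W_scaled(1)[OF elim(2)] by (intro mult_mono) auto
      thus False using lambert_W_scaled(2)[OF elim(2)] elim(1) by linarith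
    qed
  qed
qed

text \<open>For w >= 1 one has 2 e^w <= pi w e^w = 2n. This is what converts the powers of
  \<open>w\<close> in the error into powers of log n.\<close>

lemma lambert_W_le_ln: "eventually (\<lambda>n. lambert_W (2 * real n / pi) \<le> ln (real n)) sequentially"
proof -
  have "eventually (\<lambda>n. 1 \<le> lambert_W (2 * real n / pi)) sequentially"
    using filterlim_lambert_W_scaled by (simp add: filterlim_at_top)
  thus ?thesis using eventually_gt_at_top[of 0]
  proof eventually_elim
    case (elim n)
    let ?w = "lambert_W (2 * real n / pi)"
    have "2 * 1 * exp ?w \<le> pi * ?w * exp ?w" using elim pi_gt3 by (intro mult_right_mono mult_mono) auto
    also have "\<dots> = 2 * real n" by (rule lambert_W_scaled(2)[OF elim(2)])
    finally have "exp ?w \<le> real n" by simp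
    thus ?case using elim(2) by (simp add: ln_ge_iff)
  qed
qed

section \<open>Rationality of the coefficients\<close>

definition rational_on_pos :: "(real \<Rightarrow> real) \<Rightarrow> bool" where
  "rational_on_pos f \<longleftrightarrow> (\<exists>p q :: real poly. \<forall>x>0. poly q x \<noteq> 0 \<and> f x = poly p x / poly q x)"

lemma rational_on_posI:
  assumes "\<And>x. x > 0 \<Longrightarrow> poly q x \<noteq> 0" "\<And>x. x > 0 \<Longrightarrow> f x = poly p x / poly q x"
  shows "rational_on_pos f"
  using assms unfolding rational_on_pos_def by blast

lemma rational_const: "rational_on_pos (\<lambda>_. c)"
  by (rule rational_on_posI[of 1 _ "[:c:]"]) auto

lemma rational_id: "rational_on_pos (\<lambda>x. x)"
  by (rule rational_on_posI[of 1 _ "[:0, 1:]"]) auto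

lemma rational_inverse: "rational_on_pos (\<lambda>x. 1 / x)"
  by (rule rational_on_posI[of "[:0, 1:]" _ 1]) auto

lemma rational_inverse_Suc: "rational_on_pos (\<lambda>x. 1 / (x + 1))"
  by (rule rational_on_posI[of "[:1, 1:]" _ 1]) (auto simp: add_ac)

lemma rational_add:
  assumes "rational_on_pos f" "rational_on_pos g"
  shows "rational_on_pos (\<lambda>x. f x + g x)"
proof -
  from assms obtain p q p' q' where "\<forall>x>0. poly q x \<noteq> 0 \<and> f x = poly p x / poly q x"
    "\<forall>x>0. poly q' x \<noteq> 0 \<and> g x = poly p' x / poly q' x" unfolding rational_on_pos_def by blast
  thus ?thesis by (intro rational_on_posI[of "q * q'" _ "p * q' + p' * q"]) (auto simp: add_frac_eq)
qed

lemma rational_mult: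
  assumes "rational_on_pos f" "rational_on_pos g"
  shows "rational_on_pos (\<lambda>x. f x * g x)"
proof -
  from assms obtain p q p' q' where "\<forall>x>0. poly q x \<noteq> 0 \<and> f x = poly p x / poly q x"
    "\<forall>x>0. poly q' x \<noteq> 0 \<and> g x = poly p' x / poly q' x" unfolding rational_on_pos_def by blast
  thus ?thesis by (intro rational_on_posI[of "q * q'" _ "p * p'"]) auto
qed

lemma rational_power: "rational_on_pos f \<Longrightarrow> rational_on_pos (\<lambda>x. f x ^ n)"
  by (induction n) (auto intro: rational_const rational_mult)

lemma rational_sum: "(\<And>i. i \<in> A \<Longrightarrow> rational_on_pos (f i)) \<Longrightarrow> rational_on_pos (\<lambda>x. \<Sum>i\<in>A. f i x)"
  by (induction A rule: infinite_finite_induct) (auto intro: rational_const rational_add)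

lemmas rational_intros = rational_const rational_id rational_inverse rational_inverse_Suc
  rational_add rational_mult rational_power rational_sum

lemma rational_ell: "rational_on_pos (ell i)"
proof -
  have "ell i = (\<lambda>u. \<Sum>j=1..i. bell_hat log_coeff i j * ((- 1) ^ (j + 1) / real j * (1 / u) ^ j))"
    by (auto simp: ell_def fun_eq_iff power_divide intro!: sum.cong)
  thus ?thesis by (simp only:) (intro rational_intros)
qed

text \<open>Induction on the exponent \<open>j\<close>: one more factor of the power series is a
  finite convolution, under which rationality is preserved.\<close>

lemma rational_bell_hat:
  assumes "\<And>m. rational_on_pos (p m)"
  shows "rational_on_pos (\<lambda>x. bell_hat (\<lambda>m. p m x) i j)"
proof (induction j arbitrary: i)
  case 0
  thus ?case by (simp add: bell_hat_def rational_const)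
next
  case (Suc j)
  have "bell_hat (\<lambda>m. p m x) i (Suc j) =
      (\<Sum>k=0..i. (if k = 0 then 0 else p k x) * bell_hat (\<lambda>m. p m x) (i - k) j)" for x
    by (simp add: bell_hat_def fps_mult_nth)
  moreover have "rational_on_pos (\<lambda>x. if k = 0 then 0 else p k x)" for k
    using assms by (cases "k = 0") (auto intro: rational_const)
  ultimately show ?case using Suc by (simp only:) (intro rational_intros)
qed

lemma rational_f_coeff: "rational_on_pos (f_coeff \<beta> m)"
proof -
  have p: "rational_on_pos (p_coeff i)" for i
  proof -
    have "p_coeff i = (\<lambda>v. \<Sum>j=0..i. 1 / fact j * (- (1 / 8) * v) ^ j * bell_hat log_coeff i j)"
      by (simp add: p_coeff_def fun_eq_iff)
    thus ?thesis by (simp only:) (intro rational_intros)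
  qed
  have "rational_on_pos (\<lambda>v. case j of (j1, j2, j3) \<Rightarrow> (\<beta> gchoose j1) * p_coeff j2 v * q_coeff j3)" for j
    by (cases j) (simp, intro rational_intros p)
  thus ?thesis unfolding f_coeff_def[abs_def] by (intro rational_sum)
qed

lemma rational_A_coeff: "rational_on_pos (A_coeff \<beta> r)"
proof -
  have "A_coeff \<beta> r = (\<lambda>v. \<Sum>j=0..2 * r. odd_dfact (j + r) / fact j * (v\<^sup>2 * (1 / (v + 1))) ^ (j + r) *
     (\<Sum>i=j..2 * r. bell_hat (\<lambda>m. ell (m + 2) v) i j * f_coeff \<beta> (2 * r - i) v))"
    by (simp add: A_coeff_def fun_eq_iff)
  thus ?thesis by (simp only:) (intro rational_intros rational_bell_hat rational_ell rational_f_coeff)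
qed

lemma rational_tau: "rational_on_pos (tau r)"
proof -
  have "tau r = (\<lambda>w. 1 / 2 ^ (r + 1) *
     (2 * A_coeff (5 / 4) r w + (- 3) * w * (if r = 0 then 0 else A_coeff (1 / 4) (r - 1) w)))"
    by (simp add: tau_def fun_eq_iff)
  moreover have "rational_on_pos (\<lambda>w. if r = 0 then 0 else A_coeff (1 / 4) (r - 1) w)"
    using rational_A_coeff by (cases "r = 0") (auto intro: rational_const)
  ultimately show ?thesis by (simp only:) (intro rational_intros rational_A_coeff)
qed

text \<open>Since M = 2n, the remainder of the saddle expansion is of order (w^3/(2n))^K, and w <=
  log n eventually. The error from the later theta summands is smaller than any power of e^(-w), so
  it fits into the same bound.\<close>

lemma turan_remainder_bigo:
  fixes w :: "nat \<Rightarrow> real"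
  defines "w \<equiv> (\<lambda>n. lambert_W (2 * real n / pi))"
  assumes "K \<ge> 1"
  shows "(\<lambda>n. turan_b n / turan_leading n (w n) - (\<Sum>k<K. tau k (w n) / real n ^ k))
    \<in> O(\<lambda>n. ln (real n) ^ (3 * K) / real n ^ K)"
proof -
  obtain K' where K: "K = Suc K'" using assms(2) by (cases K) auto
  have lim: "filterlim w at_top sequentially" unfolding w_def by (rule filterlim_lambert_W_scaled)
  have w: "w n > 0" "pi * w n * exp (w n) = 2 * real n" if "n > 0" for n
    using lambert_W_scaled[OF that] by (auto simp: w_def)
  obtain C where C: "C \<ge> 0" "\<And>w n. w \<ge> 256 \<Longrightarrow> n > 0 \<Longrightarrow> pi * w * exp w = 2 * real n \<Longrightarrow>
     \<bar>turan_b n / turan_leading n w - saddle_combination w / combination_scale w\<bar> \<le>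
       C * exp (w\<^sup>2 / 16 - ln 2 * pi * exp w) / combination_scale w"
    using turan_ratio_approx by blast
  define g where "g = (\<lambda>w. (w ^ 3 / (pi * w * exp w)) ^ K)"
  define main where "main = (\<lambda>w. saddle_combination w / combination_scale w -
       (\<Sum>r<K. tau r w * 2 ^ r / (pi * w * exp w) ^ r))"
  define err where "err = (\<lambda>w. exp (w\<^sup>2 / 16 - ln 2 * pi * exp w) / combination_scale w)"
  have "err \<in> O[at_top](\<lambda>w. exp (- (real K * w)))"
    unfolding err_def combination_scale_def saddle_width_def by real_asymp
  hence err: "err \<in> O[at_top](g)"
    using exp_minus_power_bigo unfolding g_def by (rule landau_o.big_trans)
  have main: "main \<in> O[at_top](g)"
    unfolding main_def g_def K by (rule saddle_combination_expansion)
  have main': "(\<lambda>n. main (w n)) \<in> O(\<lambda>n. g (w n))"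
    by (rule landau_o.big.compose[OF main lim])
  have err': "(\<lambda>n. C * err (w n)) \<in> O(\<lambda>n. g (w n))"
    by (intro bigo_cmult_left landau_o.big.compose[OF err lim])
  have rest: "(\<lambda>n. turan_b n / turan_leading n (w n) - saddle_combination (w n) / combination_scale (w n))
      \<in> O(\<lambda>n. C * err (w n))"
  proof (rule landau_o.big_mono)
    have "eventually (\<lambda>n. w n \<ge> 256) sequentially" using lim by (simp add: filterlim_at_top)
    thus "eventually (\<lambda>n. norm (turan_b n / turan_leading n (w n) -
        saddle_combination (w n) / combination_scale (w n)) \<le> norm (C * err (w n))) sequentially"
      using eventually_gt_at_top[of 0]
    proof eventually_elim
      case (elim n)
      show ?case using C(2)[OF elim w(2)[OF elim(2)]] unfolding err_def real_norm_def
        by (simp only: times_divide_eq_right)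
    qed
  qed
  have "(\<lambda>n. (turan_b n / turan_leading n (w n) - saddle_combination (w n) / combination_scale (w n)) + main (w n))
      \<in> O(\<lambda>n. g (w n))"
    by (intro sum_in_bigo main' landau_o.big_trans[OF rest err'])
  also have "(\<lambda>n. g (w n)) \<in> O(\<lambda>n. ln (real n) ^ (3 * K) / real n ^ K)"
  proof (rule landau_o.big_mono)
    show "eventually (\<lambda>n. norm (g (w n)) \<le> norm (ln (real n) ^ (3 * K) / real n ^ K)) sequentially"
      using lambert_W_le_ln[folded w_def] eventually_gt_at_top[of 0]
    proof eventually_elim
      case (elim n)
      have "w n \<le> ln (real n)" using elim(1) by (simp add: w_def)
      hence "w n ^ 3 / (2 * real n) \<le> ln (real n) ^ 3 / real n"
        using elim w(1)[OF elim(2)] by (intro frac_le power_mono) auto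
      hence "(w n ^ 3 / (2 * real n)) ^ K \<le> (ln (real n) ^ 3 / real n) ^ K"
        using w(1)[OF elim(2)] by (intro power_mono) auto
      also have "\<dots> = ln (real n) ^ (3 * K) / real n ^ K" by (simp add: power_divide power_mult)
      also have "\<dots> \<le> norm (ln (real n) ^ (3 * K) / real n ^ K)" unfolding real_norm_def by (rule abs_ge_self)
      also have "(w n ^ 3 / (2 * real n)) ^ K = norm (g (w n))"
        unfolding g_def w(2)[OF elim(2)] using w(1)[OF elim(2)] by simp
      finally show ?case .
    qed
  qed
  finally have "(\<lambda>n. (turan_b n / turan_leading n (w n) - saddle_combination (w n) / combination_scale (w n)) + main (w n))
      \<in> O(\<lambda>n. ln (real n) ^ (3 * K) / real n ^ K)" .
  also have "?this \<longleftrightarrow> ?thesis"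
  proof (rule landau_o.big.in_cong, rule eventually_mono[OF eventually_gt_at_top[of 0]])
    fix n :: nat assume n: "n > 0"
    have "tau k (w n) * 2 ^ k / (pi * w n * exp (w n)) ^ k = tau k (w n) / real n ^ k" for k
      unfolding w(2)[OF n] by (simp add: power_mult_distrib)
    thus "(turan_b n / turan_leading n (w n) - saddle_combination (w n) / combination_scale (w n)) + main (w n) =
        turan_b n / turan_leading n (w n) - (\<Sum>k<K. tau k (w n) / real n ^ k)"
      unfolding main_def by simp
  qed
  finally show ?thesis .
qed

lemma tau_0: "tau 0 x = 1"
proof -
  have "{(j1, j2, j3). j1 + j2 + j3 = (0::nat)} = {(0, 0, 0)}" by auto
  thus ?thesis
    by (simp add: tau_def A_coeff_def odd_dfact_def bell_hat_def f_coeff_def p_coeff_def q_coeff_def)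
qed

theorem theorem1p6:
  fixes w :: "nat \<Rightarrow> real"
  defines "w \<equiv> (\<lambda>n. lambert_W (2 * real n / pi))"
  shows
    "(\<forall>K\<ge>1. \<exists>E :: nat \<Rightarrow> real.
        E \<in> O(\<lambda>n. ln (real n) ^ (3 * K) / real n ^ K) \<and>
        (\<forall>\<^sub>F n in sequentially.
          turan_b n =
            4 * pi\<^sup>2 * (exp (7 * w n / 4 - (w n)\<^sup>2 / 16) / fact (2 * n)) *
            sqrt (2 * w n / (w n + 1)) * (w n / (4 * exp (1 / w n))) ^ (2 * n) *
            (1 + (\<Sum>k=1..K - 1. tau k (w n) / real n ^ k) + E n))) \<and>
     (\<forall>k\<ge>1.
        (\<exists>p q :: real poly. \<forall>x>0. poly q x \<noteq> 0 \<and> tau k x = poly p x / poly q x) \<and>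
        (\<lambda>n. tau k (w n)) \<in> O(\<lambda>n. ln (real n) ^ (3 * k)))"
proof (intro conjI allI impI)
  define E where "E K n = turan_b n / turan_leading n (w n) - (\<Sum>k<K. tau k (w n) / real n ^ k)" for K n
  have E: "E K \<in> O(\<lambda>n. ln (real n) ^ (3 * K) / real n ^ K)" if "K \<ge> 1" for K
    unfolding E_def w_def using that by (rule turan_remainder_bigo)
  {
    fix K :: nat assume K: "K \<ge> 1"
    show "\<exists>E :: nat \<Rightarrow> real.
        E \<in> O(\<lambda>n. ln (real n) ^ (3 * K) / real n ^ K) \<and>
        (\<forall>\<^sub>F n in sequentially.
          turan_b n =
            4 * pi\<^sup>2 * (exp (7 * w n / 4 - (w n)\<^sup>2 / 16) / fact (2 * n)) *
            sqrt (2 * w n / (w n + 1)) * (w n / (4 * exp (1 / w n))) ^ (2 * n) *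
            (1 + (\<Sum>k=1..K - 1. tau k (w n) / real n ^ k) + E n))"
    proof (rule exI, rule conjI[OF E[OF K]], rule eventually_mono[OF eventually_gt_at_top[of 0]])
      fix n :: nat assume n: "n > 0"
      have "turan_leading n (w n) \<noteq> 0"
        using turan_leading_pos[of "w n" n] lambert_W_scaled(1)[OF n] by (simp add: w_def)
      \<comment> \<open>The term of index 0 is identically 1 and becomes the leading summand; it is
        present because \<open>K \<ge> 1\<close>.\<close>
      moreover have "(\<Sum>k<K. tau k (w n) / real n ^ k) = 1 + (\<Sum>k=1..K - 1. tau k (w n) / real n ^ k)"
      proof -
        have "{..<K} = insert 0 {1..K - 1}" using K by auto
        thus ?thesis by (simp add: tau_0)
      qed
      ultimately have "turan_b n = turan_leading n (w n) *
          (1 + (\<Sum>k=1..K - 1. tau k (w n) / real n ^ k) + E K n)"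
        by (simp add: E_def)
      thus "turan_b n =
            4 * pi\<^sup>2 * (exp (7 * w n / 4 - (w n)\<^sup>2 / 16) / fact (2 * n)) *
            sqrt (2 * w n / (w n + 1)) * (w n / (4 * exp (1 / w n))) ^ (2 * n) *
            (1 + (\<Sum>k=1..K - 1. tau k (w n) / real n ^ k) + E K n)"
        by (simp only: turan_leading_def)
    qed
  }
  fix k :: nat assume k: "k \<ge> 1"
  show "\<exists>p q :: real poly. \<forall>x>0. poly q x \<noteq> 0 \<and> tau k x = poly p x / poly q x"
    using rational_tau[of k] by (simp add: rational_on_pos_def)
  \<comment> \<open>The summand of index \<open>k\<close> is the difference of two consecutive remainders.\<close>
  have "(\<lambda>n. ln (real n) ^ 3 / real n) \<in> O(\<lambda>n. 1)" by real_asymp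
  hence "(\<lambda>n. ln (real n) ^ (3 * k) / real n ^ k * (ln (real n) ^ 3 / real n))
      \<in> O(\<lambda>n. ln (real n) ^ (3 * k) / real n ^ k * 1)"
    by (intro landau_o.big.mult) auto
  hence "(\<lambda>n. ln (real n) ^ (3 * Suc k) / real n ^ Suc k) \<in> O(\<lambda>n. ln (real n) ^ (3 * k) / real n ^ k)"
    by (simp add: power_add mult_ac)
  hence "E (Suc k) \<in> O(\<lambda>n. ln (real n) ^ (3 * k) / real n ^ k)"
    using E[of "Suc k"] by (auto intro: landau_o.big_trans)
  hence "(\<lambda>n. E k n - E (Suc k) n) \<in> O(\<lambda>n. ln (real n) ^ (3 * k) / real n ^ k)"
    using E[OF k] by (intro sum_in_bigo)
  hence "(\<lambda>n. (E k n - E (Suc k) n) * real n ^ k) \<in> O(\<lambda>n. ln (real n) ^ (3 * k) / real n ^ k * real n ^ k)"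
    by (intro landau_o.big.mult) auto
  also have "?this \<longleftrightarrow> (\<lambda>n. tau k (w n)) \<in> O(\<lambda>n. ln (real n) ^ (3 * k))"
    by (rule landau_o.big.cong_ex) (auto simp: E_def eventually_at_top_linorder intro!: exI[of _ 1])
  finally show "(\<lambda>n. tau k (w n)) \<in> O(\<lambda>n. ln (real n) ^ (3 * k))" .
qed

end
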